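(* Let $\alpha\in(0,1)$ and $\theta_1,\theta_2\ge0$ with $\theta_1+\theta_2>0$. The ranked interval lengths (interval lengths listed in decreasing order) of a $\mathtt{PDIP}^{(\alpha)}(\theta_1,\theta_2)$ have $\mathtt{PD}^{(\alpha)}(\theta)$ distribution on $\nabla_\infty$ with $\theta:=\theta_1+\theta_2-\alpha>-\alpha$.
   Context: **Interval partitions.** For $M\ge 0$, an interval partition of $[0,M]$ is a set $\gamma$ of disjoint non-empty open subintervals of $[0,M]$ such that $G(\gamma):=[0,M]\setminus\bigcup_{U\in\gamma}U$ has Lebesgue measure zero. $\mathcal I_H$ is the set of all interval partitions for all $M\ge0$, with metric $d_H(\gamma,\gamma')$ = Hausdorff distance between $G(\gamma)$ and $G(\gamma')$; $\mathcal I_{H,1}$ is the set of interval partitions of $[0,1]$. For $c>0$, $c\beta:=\{(ca,cb):(a,b)\in\beta\}$. A composition $(n_1,\ldots,n_k)$ is identified with $\{(s_{i-1},s_i):1\le i\le k\}\in\mathcal I_H$, $s_i=n_1+\cdots+n_i$. **PDIP.** An $\mathrm{oCRP}^{(\alpha)}(\theta_1,\theta_2)$ is the Markov chain $(C(n),n\ge1)$, $C(n)$ a composition of $n$ (numbers of customers at ordered tables), with $C(1)=(1)$, in which, given $C(n)$, the $(n+1)$-st customer joins a given table with $m$ customers with probability $(m-\alpha)/(n+\theta)$, starts a new table at the very left (resp. right) with probability $\theta_1/(n+\theta)$ (resp. $\theta_2/(n+\theta)$), and starts a new table between any given pair of neighbouring tables with probability $\alpha/(n+\theta)$, where $\theta=\theta_1+\theta_2-\alpha$.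 As $n\to\infty$, $\frac1nC(n)$ converges a.s. under $d_H$ to a random element of $\mathcal I_{H,1}$; its law is $\mathtt{PDIP}^{(\alpha)}(\theta_1,\theta_2)$. **Poisson–Dirichlet.** $\nabla_\infty=\{(x_1,x_2,\ldots):x_1\ge x_2\ge\cdots\ge0,\sum_ix_i=1\}$. For $\alpha\in(0,1)$, $\theta>-\alpha$, $\mathtt{PD}^{(\alpha)}(\theta)$ is the two-parameter (Pitman–Yor) Poisson–Dirichlet distribution: the law of the decreasing rearrangement of $\big(W_i\prod_{j<i}(1-W_j)\big)_{i\ge1}$ with independent $W_i\sim\mathtt{Beta}(1-\alpha,\theta+i\alpha)$. *)

theory Defs
  imports "HOL-Probability.Probability"
begin

section \<open>Interval partitions\<close>

definition interval_partition :: "real \<Rightarrow> real set set \<Rightarrow> bool" where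
  "interval_partition M \<gamma> \<longleftrightarrow> 0 \<le> M
     \<and> (\<forall>U\<in>\<gamma>. \<exists>a b. 0 \<le> a \<and> a < b \<and> b \<le> M \<and> U = {a<..<b})
     \<and> disjoint \<gamma>
     \<and> {0..M} - \<Union>\<gamma> \<in> null_sets lborel"

definition IH :: "real set set set" where
  "IH = {\<gamma>. \<exists>M. interval_partition M \<gamma>}"

definition IH1 :: "real set set set" where
  "IH1 = {\<gamma>. interval_partition 1 \<gamma>}"

text \<open>The number \<open>M\<close> is determined by \<open>\<gamma>\<close>, see \<open>interval_partition_mass\<close> below.\<close>

definition total_mass :: "real set set \<Rightarrow> real" where
  "total_mass \<gamma> = (THE M. interval_partition M \<gamma>)"

definition gap_set :: "real set set \<Rightarrow> real set" where
  "gap_set \<gamma> = {0..total_mass \<gamma>} - \<Union>\<gamma>"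

text \<open>The value \<open>0\<close> for empty sets is a convention only: \<open>gap_set \<gamma>\<close> is non-empty and compact for
  every interval partition.\<close>

definition hausdorff_distance :: "'a::metric_space set \<Rightarrow> 'a set \<Rightarrow> real" where
  "hausdorff_distance A B =
     (if A = {} \<or> B = {} then 0 else max (SUP x\<in>A. infdist x B) (SUP y\<in>B. infdist y A))"

definition d_H :: "real set set \<Rightarrow> real set set \<Rightarrow> real" where
  "d_H \<gamma> \<gamma>' = hausdorff_distance (gap_set \<gamma>) (gap_set \<gamma>')"

definition scale :: "real \<Rightarrow> real set set \<Rightarrow> real set set" where
  "scale c \<beta> = {{c * a<..<c * b} | a b. a < b \<and> {a<..<b} \<in> \<beta>}"

text \<open>Borel \<open>\<sigma>\<close>-algebra of the metric space \<open>(IH1, d_H)\<close>.\<close>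

definition borel_IH1 :: "real set set measure" where
  "borel_IH1 = sigma IH1 {U. openin (Metric_space.mtopology IH1 d_H) U}"

definition composition_partition :: "nat list \<Rightarrow> real set set" where
  "composition_partition c =
     {{real (sum_list (take i c))<..<real (sum_list (take (Suc i) c))} | i. i < length c}"

lemma interval_partition_mass_le:
  assumes "interval_partition M \<gamma>" "interval_partition M' \<gamma>"
  shows "M' \<le> M"
proof (rule ccontr)
  assume "\<not> M' \<le> M"
  then have less: "M < M'" by simp
  have "{M<..<M'} \<subseteq> {0..M'} - \<Union>\<gamma>"
    using assms(1) unfolding interval_partition_def by fastforce
  moreover have "{0..M'} - \<Union>\<gamma> \<in> null_sets lborel"
    using assms(2) unfolding interval_partition_def by blast
  ultimately have "{M<..<M'} \<in> null_sets lborel"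
    using null_sets_subset by (metis borel_open open_greaterThanLessThan sets_lborel)
  then have "emeasure lborel {M<..<M'} = 0" by (rule null_setsD1)
  then show False using less by simp
qed

lemma interval_partition_mass:
  assumes "interval_partition M \<gamma>"
  shows "total_mass \<gamma> = M"
  unfolding total_mass_def
  using assms interval_partition_mass_le by (intro the_equality) (auto intro: antisym)

lemma interval_partition_endpoints:
  assumes ip: "interval_partition M \<gamma>" and U: "{a<..<b} \<in> \<gamma>" and ab: "a < b"
  shows "a \<notin> \<Union>\<gamma>" "b \<notin> \<Union>\<gamma>"
proof -
  have aux: False if x: "x = a \<or> x = b" and xin: "x \<in> \<Union>\<gamma>" for x
  proof -
    obtain V where V: "V \<in> \<gamma>" "x \<in> V" using xin by blast
    then obtain c d where cd: "V = {c<..<d}"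
      using ip unfolding interval_partition_def by blast
    have "V \<noteq> {a<..<b}" using V x by auto
    then have disj: "V \<inter> {a<..<b} = {}"
      using ip U V(1) unfolding interval_partition_def disjoint_def by blast
    show False
    proof (cases "x = a")
      case True
      then have "max a c < min b d" using V cd ab by auto
      then obtain y where "max a c < y" "y < min b d" using dense by blast
      then show False using disj cd by auto
    next
      case False
      then have "max a c < min b d" using x V cd ab by auto
      then obtain y where "max a c < y" "y < min b d" using dense by blast
      then show False using disj cd by auto
    qed
  qed
  show "a \<notin> \<Union>\<gamma>" "b \<notin> \<Union>\<gamma>" using aux by blast+
qed

lemma interval_partition_subset_if_Union_eq:
  assumes ip: "interval_partition M \<gamma>" "interval_partition M' \<gamma>'" and eq: "\<Union>\<gamma> = \<Union>\<gamma>'"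
  shows "\<gamma> \<subseteq> \<gamma>'"
proof
  fix U assume U: "U \<in> \<gamma>"
  obtain a b where ab: "a < b" "U = {a<..<b}"
    using ip(1) U unfolding interval_partition_def by blast
  obtain x where x: "a < x" "x < b" using ab dense by blast
  then have "x \<in> U" using ab by simp
  then have "x \<in> \<Union>\<gamma>'" using eq U by blast
  then obtain V where V: "V \<in> \<gamma>'" "x \<in> V" by blast
  then obtain c d where cd: "c < d" "V = {c<..<d}"
    using ip(2) unfolding interval_partition_def by blast
  have 1: "a \<notin> \<Union>\<gamma>" "b \<notin> \<Union>\<gamma>"
    using interval_partition_endpoints[OF ip(1)] U ab by auto
  have 2: "c \<notin> \<Union>\<gamma>'" "d \<notin> \<Union>\<gamma>'"
    using interval_partition_endpoints[OF ip(2)] V cd by auto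
  have "c \<notin> U" "d \<notin> U" using 2 U eq by blast+
  moreover have "a \<notin> V" "b \<notin> V" using 1 V eq by blast+
  ultimately have "a = c" "b = d" using x V ab cd by auto
  then show "U \<in> \<gamma>'" using ab cd V by simp
qed

lemma gap_set_props:
  assumes "\<gamma> \<in> IH"
  shows "compact (gap_set \<gamma>)" "0 \<in> gap_set \<gamma>" "total_mass \<gamma> \<in> gap_set \<gamma>" "gap_set \<gamma> \<subseteq> {0..total_mass \<gamma>}"
    "interval_partition (total_mass \<gamma>) \<gamma>" "\<Union>\<gamma> = {0..total_mass \<gamma>} - gap_set \<gamma>"
proof -
  obtain M where M: "interval_partition M \<gamma>" using assms unfolding IH_def by blast
  then have m: "total_mass \<gamma> = M" by (rule interval_partition_mass)
  then show "interval_partition (total_mass \<gamma>) \<gamma>" using M by simp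
  have "open (\<Union>\<gamma>)" using M unfolding interval_partition_def by (intro open_Union) fastforce
  then show "compact (gap_set \<gamma>)" unfolding gap_set_def by (intro compact_diff) auto
  have 0: "0 \<notin> \<Union>\<gamma>" "M \<notin> \<Union>\<gamma>" "\<Union>\<gamma> \<subseteq> {0..M}"
    using M unfolding interval_partition_def by fastforce+
  moreover have "0 \<le> M" using M unfolding interval_partition_def by simp
  ultimately show "0 \<in> gap_set \<gamma>" "total_mass \<gamma> \<in> gap_set \<gamma>" "\<Union>\<gamma> = {0..total_mass \<gamma>} - gap_set \<gamma>"
    unfolding gap_set_def m by auto
  show "gap_set \<gamma> \<subseteq> {0..total_mass \<gamma>}" unfolding gap_set_def by auto
qed

lemma bdd_above_infdist:
  assumes "bounded T"
  shows "bdd_above ((\<lambda>x. infdist x S) ` T)"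
proof (cases "T = {}")
  case False
  then obtain t where t: "t \<in> T" by blast
  obtain e where e: "\<And>x. x \<in> T \<Longrightarrow> dist t x \<le> e"
    using assms bounded_any_center by metis
  have "infdist x S \<le> infdist t S + e" if "x \<in> T" for x
    using infdist_triangle[of x S t] e[OF that] by (simp add: dist_commute)
  then show ?thesis by (intro bdd_aboveI2) auto
qed simp

lemma hausdorff_distance_nonneg:
  assumes "bounded A"
  shows "0 \<le> hausdorff_distance A B"
proof (cases "A = {} \<or> B = {}")
  case False
  then obtain x where x: "x \<in> A" by blast
  have "0 \<le> infdist x B" by (rule infdist_nonneg)
  also have "\<dots> \<le> (SUP x\<in>A. infdist x B)"
    by (rule cSUP_upper[OF x bdd_above_infdist[OF assms]])
  finally show ?thesis using False by (simp add: hausdorff_distance_def le_max_iff_disj)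
qed (auto simp: hausdorff_distance_def)

lemma hausdorff_distance_le_iff:
  fixes A B :: "'a::metric_space set"
  assumes "compact A" "compact B" "A \<noteq> {}" "B \<noteq> {}"
  shows "hausdorff_distance A B \<le> r \<longleftrightarrow> (\<forall>x\<in>A. infdist x B \<le> r) \<and> (\<forall>y\<in>B. infdist y A \<le> r)"
proof -
  have bdd: "bdd_above ((\<lambda>x. infdist x S) ` T)" if "compact T" for S T :: "'a set"
    using that by (intro bdd_above_infdist compact_imp_bounded)
  show ?thesis
    using assms by (simp add: hausdorff_distance_def cSUP_le_iff bdd)
qed

lemma gap_set_inject:
  assumes "\<gamma> \<in> IH" "\<gamma>' \<in> IH" "gap_set \<gamma> = gap_set \<gamma>'"
  shows "\<gamma> = \<gamma>'"
proof -
  have "total_mass \<gamma> = total_mass \<gamma>'"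
    using gap_set_props[OF assms(1)] gap_set_props[OF assms(2)] assms(3) by (metis antisym atLeastAtMost_iff subsetD)
  then have "\<Union>\<gamma> = \<Union>\<gamma>'"
    using gap_set_props[OF assms(1)] gap_set_props[OF assms(2)] assms(3) by simp
  then show ?thesis
    using interval_partition_subset_if_Union_eq gap_set_props(5) assms by (metis subset_antisym)
qed

lemma Metric_space_IH: "Metric_space IH d_H"
proof
  have le: "infdist x (gap_set \<gamma>') \<le> d_H \<gamma> \<gamma>'" "infdist y (gap_set \<gamma>) \<le> d_H \<gamma> \<gamma>'"
    if "\<gamma> \<in> IH" "\<gamma>' \<in> IH" "x \<in> gap_set \<gamma>" "y \<in> gap_set \<gamma>'" for \<gamma> \<gamma>' x y
    using hausdorff_distance_le_iff[of "gap_set \<gamma>" "gap_set \<gamma>'" "d_H \<gamma> \<gamma>'"] gap_set_props that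
    unfolding d_H_def by blast+
  have nonempty: "gap_set \<gamma> \<noteq> {}" if "\<gamma> \<in> IH" for \<gamma> using gap_set_props(2)[OF that] by blast
  have bad: "d_H \<gamma> \<gamma>' \<le> r" if "\<gamma> \<in> IH" "\<gamma>' \<in> IH"
    "\<And>x. x \<in> gap_set \<gamma> \<Longrightarrow> infdist x (gap_set \<gamma>') \<le> r" "\<And>y. y \<in> gap_set \<gamma>' \<Longrightarrow> infdist y (gap_set \<gamma>) \<le> r" for \<gamma> \<gamma>' r
    using hausdorff_distance_le_iff[of "gap_set \<gamma>" "gap_set \<gamma>'" r] gap_set_props(1) nonempty that
    unfolding d_H_def by blast
  show comm: "d_H \<gamma> \<gamma>' = d_H \<gamma>' \<gamma>" for \<gamma> \<gamma>'
    unfolding d_H_def hausdorff_distance_def by (auto simp: max.commute)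
  have tri: "infdist x (gap_set c) \<le> d_H a b + d_H b c"
    if abcx: "a \<in> IH" "b \<in> IH" "c \<in> IH" "x \<in> gap_set a" for a b c x
  proof -
    obtain y where y: "y \<in> gap_set b" "infdist x (gap_set b) = dist x y"
      using infdist_attains_inf[OF compact_imp_closed[OF gap_set_props(1)[OF abcx(2)]] nonempty[OF abcx(2)]]
      by blast
    have "infdist x (gap_set c) \<le> infdist y (gap_set c) + dist x y" by (rule infdist_triangle)
    also have "\<dots> \<le> d_H b c + d_H a b"
      using le(1)[OF abcx(2,3) y(1) gap_set_props(2)[OF abcx(3)]] le(1)[OF abcx(1,2,4) y(1)] y(2)
      by simp
    finally show ?thesis by simp
  qed
  show "d_H a c \<le> d_H a b + d_H b c" if abc: "a \<in> IH" "b \<in> IH" "c \<in> IH" for a b c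
  proof (rule bad[OF abc(1,3)])
    show "infdist x (gap_set c) \<le> d_H a b + d_H b c" if "x \<in> gap_set a" for x
      using tri[OF abc that] .
    show "infdist y (gap_set a) \<le> d_H a b + d_H b c" if "y \<in> gap_set c" for y
      using tri[OF abc(3,2,1) that] comm[of a b] comm[of b c] by simp
  qed
  show nonneg: "0 \<le> d_H \<gamma> \<gamma>'" for \<gamma> \<gamma>'
    unfolding d_H_def gap_set_def
    by (intro hausdorff_distance_nonneg bounded_subset[OF bounded_closed_interval[of 0 "total_mass \<gamma>"]]) auto
  show "d_H a b = 0 \<longleftrightarrow> a = b" if "a \<in> IH" "b \<in> IH" for a b
  proof
    assume "a = b"
    then have "d_H a b \<le> 0" using that by (intro bad) auto
    then show "d_H a b = 0" using nonneg[of a b] by simp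
  next
    assume 0: "d_H a b = 0"
    have zero: "x \<in> gap_set c" if cI: "c \<in> IH" and le0: "infdist x (gap_set c) \<le> 0" for x c
      using in_closed_iff_infdist_zero[OF compact_imp_closed[OF gap_set_props(1)[OF cI]]
          nonempty[OF cI]] le0 infdist_nonneg[of x "gap_set c"] by simp
    have "gap_set a \<subseteq> gap_set b"
      using le(1)[OF that _ gap_set_props(2)[OF that(2)]] 0 zero[OF that(2)] by auto
    moreover have "gap_set b \<subseteq> gap_set a"
      using le(2)[OF that gap_set_props(2)[OF that(1)]] 0 zero[OF that(1)] by auto
    ultimately show "a = b" using gap_set_inject[OF that] by blast
  qed
qed


lemma Metric_space_IH1: "Metric_space IH1 d_H"
  by (rule Metric_space.subspace[OF Metric_space_IH]) (auto simp: IH_def IH1_def)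


section \<open>The ordered Chinese restaurant process\<close>

text \<open>A new customer either joins the table at position \<open>i\<close> (counted from \<open>0\<close>) or opens a new table
  with exactly \<open>j\<close> existing tables to its left. Distinct choices may lead to the same composition,
  so transition probabilities are sums over choices.\<close>

datatype seating = Join nat | New nat

fun seat :: "nat list \<Rightarrow> seating \<Rightarrow> nat list" where
  "seat c (Join i) = c[i := Suc (c ! i)]"
| "seat c (New j) = take j c @ [1] @ drop j c"

definition seatings :: "nat list \<Rightarrow> seating set" where
  "seatings c = Join ` {..<length c} \<union> New ` {..length c}"

fun seating_prob :: "real \<Rightarrow> real \<Rightarrow> real \<Rightarrow> nat list \<Rightarrow> seating \<Rightarrow> real" where
  "seating_prob \<alpha> \<theta>\<^sub>1 \<theta>\<^sub>2 c (Join i) =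
     (real (c ! i) - \<alpha>) / (real (sum_list c) + (\<theta>\<^sub>1 + \<theta>\<^sub>2 - \<alpha>))"
| "seating_prob \<alpha> \<theta>\<^sub>1 \<theta>\<^sub>2 c (New j) =
     (if j = 0 then \<theta>\<^sub>1 else if j = length c then \<theta>\<^sub>2 else \<alpha>)
       / (real (sum_list c) + (\<theta>\<^sub>1 + \<theta>\<^sub>2 - \<alpha>))"

definition oCRP_trans :: "real \<Rightarrow> real \<Rightarrow> real \<Rightarrow> nat list \<Rightarrow> nat list \<Rightarrow> real" where
  "oCRP_trans \<alpha> \<theta>\<^sub>1 \<theta>\<^sub>2 c c' =
     (\<Sum>s\<in>{s \<in> seatings c. seat c s = c'}. seating_prob \<alpha> \<theta>\<^sub>1 \<theta>\<^sub>2 c s)"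

text \<open>\<open>C\<close> is a Markov chain, started at the composition \<open>(1)\<close> at time \<open>1\<close>, with the transition
  probabilities above; the value \<open>C 0\<close> is irrelevant.\<close>

definition is_oCRP ::
    "real \<Rightarrow> real \<Rightarrow> real \<Rightarrow> 'a measure \<Rightarrow> (nat \<Rightarrow> 'a \<Rightarrow> nat list) \<Rightarrow> bool" where
  "is_oCRP \<alpha> \<theta>\<^sub>1 \<theta>\<^sub>2 M C \<longleftrightarrow> prob_space M
     \<and> (\<forall>n\<ge>1. C n \<in> M \<rightarrow>\<^sub>M count_space UNIV)
     \<and> (AE \<omega> in M. C 1 \<omega> = [1])
     \<and> (\<forall>n\<ge>1. \<forall>c. measure M {\<omega> \<in> space M. \<forall>i\<in>{1..Suc n}. C i \<omega> = c i}
           = measure M {\<omega> \<in> space M. \<forall>i\<in>{1..n}. C i \<omega> = c i}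
               * oCRP_trans \<alpha> \<theta>\<^sub>1 \<theta>\<^sub>2 (c n) (c (Suc n)))"

text \<open>\<open>\<mu>\<close> is the law of the almost sure \<open>d_H\<close>-limit of \<open>C(n)/n\<close> for an ordered Chinese restaurant
  process \<open>C\<close>. The limit only depends on the path of \<open>C\<close>, so it is no restriction to take the
  underlying probability space on the type of paths.\<close>

definition is_PDIP :: "real \<Rightarrow> real \<Rightarrow> real \<Rightarrow> real set set measure \<Rightarrow> bool" where
  "is_PDIP \<alpha> \<theta>\<^sub>1 \<theta>\<^sub>2 \<mu> \<longleftrightarrow> (\<exists>(M :: (nat \<Rightarrow> nat list) measure) C \<beta>.
     is_oCRP \<alpha> \<theta>\<^sub>1 \<theta>\<^sub>2 M C
     \<and> \<beta> \<in> M \<rightarrow>\<^sub>M borel_IH1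
     \<and> (AE \<omega> in M. (\<lambda>n. d_H (scale (1 / real n) (composition_partition (C n \<omega>))) (\<beta> \<omega>))
                       \<longlonglongrightarrow> 0)
     \<and> \<mu> = distr M borel_IH1 \<beta>)"

lemma seating_prob_nonneg:
  assumes "0 < \<alpha>" "\<alpha> < 1" "0 \<le> \<theta>\<^sub>1" "0 \<le> \<theta>\<^sub>2" "c \<noteq> []" "\<forall>m\<in>set c. 1 \<le> m" "s \<in> seatings c"
  shows "0 \<le> seating_prob \<alpha> \<theta>\<^sub>1 \<theta>\<^sub>2 c s"
proof -
  obtain m c' where "c = m # c'" using assms(5) by (cases c) auto
  then have "1 \<le> sum_list c" using assms(6) by auto
  then have "1 \<le> real (sum_list c)" by linarith
  moreover have "1 \<le> real (c ! i)" if "i < length c" for i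
  proof -
    have "1 \<le> c ! i" using assms(6) that nth_mem by blast
    then show ?thesis by linarith
  qed
  ultimately show ?thesis
    using assms unfolding seatings_def by (fastforce intro!: divide_nonneg_nonneg)
qed

lemma sum_seating_prob:
  assumes "0 < \<alpha>" "\<alpha> < 1" "0 \<le> \<theta>\<^sub>1" "0 \<le> \<theta>\<^sub>2" "c \<noteq> []" "\<forall>m\<in>set c. 1 \<le> m"
  shows "(\<Sum>s\<in>seatings c. seating_prob \<alpha> \<theta>\<^sub>1 \<theta>\<^sub>2 c s) = 1"
proof -
  define D where "D = real (sum_list c) + (\<theta>\<^sub>1 + \<theta>\<^sub>2 - \<alpha>)"
  obtain m c' where "c = m # c'" using assms(5) by (cases c) auto
  then have "1 \<le> sum_list c" using assms(6) by auto
  then have "1 \<le> real (sum_list c)" by linarith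
  then have D: "0 < D" using assms unfolding D_def by linarith
  obtain k where k: "length c = Suc k" using assms(5) by (cases c) auto
  have join: "(\<Sum>i<length c. (real (c ! i) - \<alpha>)) = real (sum_list c) - (real k + 1) * \<alpha>"
    by (simp add: sum_subtractf sum_list_sum_nth lessThan_atLeast0 k)
  have "(\<Sum>j\<le>length c. (if j = 0 then \<theta>\<^sub>1 else if j = length c then \<theta>\<^sub>2 else \<alpha>))
        = \<theta>\<^sub>1 + (\<Sum>j\<le>k. if j = k then \<theta>\<^sub>2 else \<alpha>)"
    by (simp add: k sum.atMost_Suc_shift del: sum.atMost_Suc)
  also have "(\<Sum>j\<le>k. if j = k then \<theta>\<^sub>2 else \<alpha>) = (\<Sum>j<k. if j = k then \<theta>\<^sub>2 else \<alpha>) + \<theta>\<^sub>2"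
    by (simp add: lessThan_Suc_atMost[symmetric])
  also have "(\<Sum>j<k. if j = k then \<theta>\<^sub>2 else \<alpha>) = (\<Sum>j<k. \<alpha>)" by (intro sum.cong) auto
  finally have new: "(\<Sum>j\<le>length c. (if j = 0 then \<theta>\<^sub>1 else if j = length c then \<theta>\<^sub>2 else \<alpha>))
        = \<theta>\<^sub>1 + \<theta>\<^sub>2 + real k * \<alpha>" by simp
  have "(\<Sum>s\<in>seatings c. seating_prob \<alpha> \<theta>\<^sub>1 \<theta>\<^sub>2 c s)
        = (\<Sum>i<length c. seating_prob \<alpha> \<theta>\<^sub>1 \<theta>\<^sub>2 c (Join i))
          + (\<Sum>j\<le>length c. seating_prob \<alpha> \<theta>\<^sub>1 \<theta>\<^sub>2 c (New j))"
    unfolding seatings_def by (subst sum.union_disjoint) (auto simp: sum.reindex inj_on_def)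
  also have "\<dots> = (real (sum_list c) - (real k + 1) * \<alpha>) / D + (\<theta>\<^sub>1 + \<theta>\<^sub>2 + real k * \<alpha>) / D"
    unfolding seating_prob.simps D_def[symmetric] sum_divide_distrib[symmetric] join new ..
  also have "\<dots> = D / D" unfolding add_divide_distrib[symmetric] D_def by (simp add: algebra_simps)
  finally show ?thesis using D by simp
qed


section \<open>Ranked lengths and the Poisson--Dirichlet distribution\<close>

text \<open>Entry \<open>k\<close> (counted from \<open>0\<close>) of the decreasing rearrangement, with multiplicities, of a
  non-negative family \<open>(f i)\<close>, \<open>i \<in> A\<close>; finite families are continued by zeros. See
  \<open>decreasing_rearrangement_eqI\<close> below.\<close>

definition decreasing_rearrangement :: "('i \<Rightarrow> real) \<Rightarrow> 'i set \<Rightarrow> nat \<Rightarrow> real" where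
  "decreasing_rearrangement f A k =
     Inf {t. 0 \<le> t \<and> finite {i \<in> A. t < f i} \<and> card {i \<in> A. t < f i} \<le> k}"

definition ranked_lengths :: "real set set \<Rightarrow> nat \<Rightarrow> real" where
  "ranked_lengths \<gamma> = decreasing_rearrangement (measure lborel) \<gamma>"

definition nabla :: "(nat \<Rightarrow> real) set" where
  "nabla = {x. decseq x \<and> (\<forall>i. 0 \<le> x i) \<and> x sums 1}"

definition borel_nabla :: "(nat \<Rightarrow> real) measure" where
  "borel_nabla = restrict_space borel nabla"

definition beta_distribution :: "real \<Rightarrow> real \<Rightarrow> real measure" where
  "beta_distribution a b = density lborel
     (\<lambda>x. ennreal (indicator {0<..<1} x * (x powr (a - 1) * (1 - x) powr (b - 1) / Beta a b)))"

definition stick_breaking :: "(nat \<Rightarrow> real) \<Rightarrow> nat \<Rightarrow> real" where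
  "stick_breaking w i = w i * (\<Prod>j<i. 1 - w j)"

text \<open>Indices start at \<open>0\<close>, so \<open>w i\<close> is \<open>W\<^sub>i\<^sub>+\<^sub>1\<close>. The decreasing rearrangement lies in \<open>nabla\<close> only
  almost surely, hence the restriction to this event at the end.\<close>

definition PD :: "real \<Rightarrow> real \<Rightarrow> (nat \<Rightarrow> real) measure" where
  "PD \<alpha> \<theta> = restrict_space
     (distr (\<Pi>\<^sub>M i\<in>UNIV. beta_distribution (1 - \<alpha>) (\<theta> + real (Suc i) * \<alpha>)) borel
        (\<lambda>w. decreasing_rearrangement (stick_breaking w) UNIV))
     nabla"

lemma decreasing_rearrangement_eqI:
  assumes dec: "decseq x" and lim: "x \<longlonglongrightarrow> 0"
    and bij: "bij_betw \<pi> {i \<in> A. 0 < f i} {k. 0 < x k}"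
    and val: "\<And>i. i \<in> A \<Longrightarrow> 0 < f i \<Longrightarrow> x (\<pi> i) = f i"
  shows "decreasing_rearrangement f A = x"
proof
  fix k
  have nonneg: "0 \<le> x k" for k using decseq_ge[OF dec lim] .
  have bt: "bij_betw \<pi> {i \<in> A. t < f i} {k. t < x k}" if t: "0 \<le> t" for t
  proof (rule bij_betw_subset[OF bij])
    show "{i \<in> A. t < f i} \<subseteq> {i \<in> A. 0 < f i}" using t by auto
    show "\<pi> ` {i \<in> A. t < f i} = {k. t < x k}"
    proof (intro equalityI subsetI)
      fix k assume "k \<in> {k. t < x k}"
      then have k: "t < x k" by simp
      then have "k \<in> \<pi> ` {i \<in> A. 0 < f i}"
        using t bij_betw_imp_surj_on[OF bij] by simp
      then show "k \<in> \<pi> ` {i \<in> A. t < f i}" using val k by auto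
    qed (use t val in auto)
  qed
  have key: "finite {i \<in> A. t < f i} \<and> card {i \<in> A. t < f i} \<le> k \<longleftrightarrow> x k \<le> t" if t: "0 \<le> t" for t
  proof -
    have eq: "finite {i \<in> A. t < f i} \<longleftrightarrow> finite {k. t < x k}"
      "card {i \<in> A. t < f i} = card {k. t < x k}"
      using bij_betw_finite[OF bt[OF t]] bij_betw_same_card[OF bt[OF t]] by auto
    show ?thesis
    proof
      assume "x k \<le> t"
      then have sub: "{k. t < x k} \<subseteq> {..<k}"
        using decseqD[OF dec] by (smt (verit, best) lessThan_iff mem_Collect_eq not_less subsetI)
      then show "finite {i \<in> A. t < f i} \<and> card {i \<in> A. t < f i} \<le> k"
        using eq finite_subset[OF sub] card_mono[OF _ sub] by simp
    next
      assume *: "finite {i \<in> A. t < f i} \<and> card {i \<in> A. t < f i} \<le> k"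
      show "x k \<le> t"
      proof (rule ccontr)
        assume "\<not> x k \<le> t"
        then have sub: "{..k} \<subseteq> {k. t < x k}"
          using decseqD[OF dec] by (smt (verit, best) atMost_iff mem_Collect_eq subsetI)
        then have "Suc k \<le> card {k. t < x k}" using card_mono[OF _ sub] * eq by simp
        then show False using * eq by simp
      qed
    qed
  qed
  have "{t. 0 \<le> t \<and> finite {i \<in> A. t < f i} \<and> card {i \<in> A. t < f i} \<le> k} = {x k..}"
    using key nonneg[of k] order_trans by auto
  then show "decreasing_rearrangement f A k = x k"
    unfolding decreasing_rearrangement_def by simp
qed

end

theory Submission
  imports Defs
begin

text \<open>
  The order of the tables is irrelevant for the ranked lengths, and without its order the restaurant
  process is the classical one, whose limiting table fractions can be computed by conditioning on them.

  Ranked lengths are Lipschitz functions of the interval partition for \<open>d_H\<close>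
  (\<open>ranked_lengths_Lipschitz\<close>), so those of the limit are almost surely the limits of the ranked
  table fractions. For ranked fractions only symmetric functions of the table sizes matter. With \<open>k\<close>
  tables the probability of a new table, wherever it is placed, is proportional to
  \<open>\<theta>\<^sub>1 + \<theta>\<^sub>2 + (k - 1) \<alpha> = \<theta> + k \<alpha>\<close>. Hence expectations of symmetric functions do not change if every
  new table is placed at the right end, which lists the tables in order of appearance
  (\<open>step_pow_seating_prob_symmetric\<close>).

  The process in order of appearance is a mixture (\<open>stick_mixture\<close>). Take stick fractions
  \<open>W\<^sub>1, W\<^sub>2, \<dots>\<close> as in the definition of the Poisson--Dirichlet law and let \<open>V\<^sub>i\<close> be the length of the
  \<open>i\<close>-th stick. Given the sticks, let each customer join the open table \<open>i\<close> with probability \<open>V\<^sub>i\<close> and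
  open a new table with the remaining probability. A sequence of seatings then has as its probability a
  product of powers of \<open>W\<^sub>i\<close> and \<open>1 - W\<^sub>i\<close>, and beta moments integrate these products to the seating
  probabilities of the Chinese restaurant process. In this description table \<open>i\<close> corresponds to stick
  \<open>i\<close>, so no size-biased reordering of the sticks has to be understood.

  Given the sticks, a second moment estimate shows that the fraction of table \<open>i\<close> tends to \<open>V\<^sub>i\<close>
  (\<open>table_fraction_LLN\<close>). As the \<open>V\<^sub>i\<close> almost surely add up to one, the convergence is uniform in \<open>i\<close>,
  and ranking is a contraction for the supremum norm; so the ranked fractions tend to the ranked sticks
  (\<open>step_pow_ranked_tendsto\<close>). Comparing the two limits on test functions that determine a law of
  sequences (\<open>measure_eqI_box_test\<close>) identifies the law of the ranked lengths with that of the ranked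
  sticks, which is the Poisson--Dirichlet law.
\<close>

section \<open>Decreasing rearrangements\<close>

text \<open>Finiteness is demanded separately because infinite sets have cardinality \<open>0\<close>.\<close>

definition exceed_at_most :: "('i \<Rightarrow> real) \<Rightarrow> 'i set \<Rightarrow> real \<Rightarrow> nat \<Rightarrow> bool" where
  "exceed_at_most f A t k \<longleftrightarrow> finite {i \<in> A. t < f i} \<and> card {i \<in> A. t < f i} \<le> k"

text \<open>Only finitely many entries lie above level \<open>1\<close>, so none lies above a suitable higher level; hence the
  infimum in the rearrangement ranges over a non-empty set for every rank.\<close>

definition vanishing :: "('i \<Rightarrow> real) \<Rightarrow> 'i set \<Rightarrow> bool" where
  "vanishing f A \<longleftrightarrow> (\<forall>t>0. finite {i \<in> A. t < f i})"

lemma decreasing_rearrangement_alt: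
  "decreasing_rearrangement f A k = Inf {t. 0 \<le> t \<and> exceed_at_most f A t k}"
  unfolding decreasing_rearrangement_def exceed_at_most_def ..

text \<open>This form avoids cardinalities. It is stable under small changes of the entries, and over the index
  set \<open>\<nat>\<close> it involves only countably many sets \<open>B\<close>, so that it is measurable in parameters.\<close>

lemma exceed_at_most_iff_subsets:
  "exceed_at_most f A t k \<longleftrightarrow>
     (\<forall>B. B \<subseteq> A \<longrightarrow> finite B \<longrightarrow> card B = Suc k \<longrightarrow> (\<exists>i\<in>B. f i \<le> t))"
proof
  assume e: "exceed_at_most f A t k"
  show "\<forall>B. B \<subseteq> A \<longrightarrow> finite B \<longrightarrow> card B = Suc k \<longrightarrow> (\<exists>i\<in>B. f i \<le> t)"
  proof (intro allI impI, rule ccontr)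
    fix B assume B: "B \<subseteq> A" "finite B" "card B = Suc k" "\<not> (\<exists>i\<in>B. f i \<le> t)"
    then have "B \<subseteq> {i \<in> A. t < f i}" by auto
    then have "card B \<le> card {i \<in> A. t < f i}"
      using e unfolding exceed_at_most_def by (intro card_mono) auto
    then show False using e B(3) unfolding exceed_at_most_def by simp
  qed
next
  assume *: "\<forall>B. B \<subseteq> A \<longrightarrow> finite B \<longrightarrow> card B = Suc k \<longrightarrow> (\<exists>i\<in>B. f i \<le> t)"
  show "exceed_at_most f A t k"
  proof (rule ccontr)
    assume "\<not> exceed_at_most f A t k"
    then have "infinite {i \<in> A. t < f i} \<or> Suc k \<le> card {i \<in> A. t < f i}"
      unfolding exceed_at_most_def by auto
    then have "\<exists>B. B \<subseteq> {i \<in> A. t < f i} \<and> finite B \<and> card B = Suc k"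
    proof
      assume "infinite {i \<in> A. t < f i}"
      from infinite_arbitrarily_large[OF this, of "Suc k"] show ?thesis by auto
    next
      assume "Suc k \<le> card {i \<in> A. t < f i}"
      from obtain_subset_with_card_n[OF this]
      obtain B where "B \<subseteq> {i \<in> A. t < f i}" "card B = Suc k" "finite B" .
      then show ?thesis by (intro exI[of _ B]) simp
    qed
    then obtain B where B: "B \<subseteq> {i \<in> A. t < f i}" "finite B" "card B = Suc k" by (elim exE conjE)
    then have "B \<subseteq> A" by blast
    then obtain i where "i \<in> B" "f i \<le> t" using * B by blast
    then show False using B(1) by auto
  qed
qed

lemma exceed_at_most_mono:
  assumes "exceed_at_most f A t k" "t \<le> t'" "k \<le> k'"
  shows "exceed_at_most f A t' k'"
proof -
  have sub: "{i \<in> A. t' < f i} \<subseteq> {i \<in> A. t < f i}" using assms(2) by auto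
  then show ?thesis
    using assms(1,3) finite_subset[OF sub] card_mono[OF _ sub] unfolding exceed_at_most_def by auto
qed

text \<open>The number of entries above a level is right-continuous in the level, so the infimum that
  defines the rearrangement is attained.\<close>

lemma exceed_at_most_right_closed:
  assumes "\<And>e. 0 < e \<Longrightarrow> exceed_at_most f A (t + e) k"
  shows "exceed_at_most f A t k"
  unfolding exceed_at_most_iff_subsets
proof (intro allI impI)
  fix B assume B: "B \<subseteq> A" "finite B" "card B = Suc k"
  then have ne: "B \<noteq> {}" by auto
  have "Min (f ` B) \<le> t + e" if "0 < e" for e
  proof -
    have "\<exists>i\<in>B. f i \<le> t + e"
      using assms[OF that] B unfolding exceed_at_most_iff_subsets by blast
    then show ?thesis using B(2) by (meson Min_le finite_imageI image_eqI order_trans)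
  qed
  then have "Min (f ` B) \<le> t" by (rule field_le_epsilon)
  then show "\<exists>i\<in>B. f i \<le> t" using Min_in[of "f ` B"] B(2) ne by fastforce
qed

text \<open>Ranked values and counts above a level determine each other. All properties of the rearrangement
  below are read off from the counts.\<close>

lemma decreasing_rearrangement_le_iff':
  assumes "0 \<le> s" "exceed_at_most f A s k"
  shows "decreasing_rearrangement f A k \<le> t \<longleftrightarrow> 0 \<le> t \<and> exceed_at_most f A t k"
proof -
  define T where "T = {t. 0 \<le> t \<and> exceed_at_most f A t k}"
  have ne: "T \<noteq> {}" and bdd: "bdd_below T" using assms unfolding T_def by auto
  have Inf: "decreasing_rearrangement f A k = Inf T"
    unfolding T_def decreasing_rearrangement_alt ..
  show ?thesis
  proof
    assume le: "decreasing_rearrangement f A k \<le> t"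
    have "exceed_at_most f A (t + e) k" if "0 < e" for e
    proof -
      have "Inf T < t + e" using le that Inf by simp
      then obtain u where "u \<in> T" "u < t + e" using cInf_lessD[OF ne] by blast
      then show ?thesis
        using exceed_at_most_mono[of f A u k "t + e" k] unfolding T_def by simp
    qed
    moreover have "0 \<le> Inf T" by (rule cInf_greatest[OF ne]) (simp add: T_def)
    ultimately show "0 \<le> t \<and> exceed_at_most f A t k"
      using le Inf exceed_at_most_right_closed[of f A t k] by auto
  next
    assume "0 \<le> t \<and> exceed_at_most f A t k"
    then show "decreasing_rearrangement f A k \<le> t"
      unfolding Inf by (intro cInf_lower[OF _ bdd]) (simp add: T_def)
  qed
qed

lemma vanishing_exceed_at_most:
  assumes "vanishing f A"
  shows "\<exists>s\<ge>0. exceed_at_most f A s k"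
proof -
  \<comment> \<open>a level above all entries exceeding \<open>1\<close>\<close>
  define s where "s = 1 + (\<Sum>i\<in>{i \<in> A. 1 < f i}. \<bar>f i\<bar>)"
  have fin: "finite {i \<in> A. 1 < f i}" using assms unfolding vanishing_def by simp
  have s: "1 \<le> s" unfolding s_def using sum_nonneg[of "{i \<in> A. 1 < f i}" "\<lambda>i. \<bar>f i\<bar>"] by simp
  have "{i \<in> A. s < f i} = {}"
  proof (rule ccontr)
    assume "{i \<in> A. s < f i} \<noteq> {}"
    then obtain i where i: "i \<in> A" "s < f i" by blast
    then have "\<bar>f i\<bar> \<le> (\<Sum>i\<in>{i \<in> A. 1 < f i}. \<bar>f i\<bar>)"
      using s by (intro member_le_sum fin) auto
    then show False using i unfolding s_def by simp
  qed
  then have "exceed_at_most f A s k" unfolding exceed_at_most_def by (simp only:) simp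
  then show ?thesis using s by (intro exI[of _ s]) auto
qed

lemma decreasing_rearrangement_le_iff:
  assumes "vanishing f A"
  shows "decreasing_rearrangement f A k \<le> t \<longleftrightarrow> 0 \<le> t \<and> exceed_at_most f A t k"
  using vanishing_exceed_at_most[OF assms] decreasing_rearrangement_le_iff' by blast

lemma decreasing_rearrangement_nonneg:
  assumes "vanishing f A"
  shows "0 \<le> decreasing_rearrangement f A k"
  using decreasing_rearrangement_le_iff[OF assms] by blast

lemma decseq_decreasing_rearrangement:
  assumes "vanishing f A"
  shows "decseq (decreasing_rearrangement f A)"
proof (rule decseq_SucI)
  fix k
  show "decreasing_rearrangement f A (Suc k) \<le> decreasing_rearrangement f A k"
    using decreasing_rearrangement_le_iff[OF assms] exceed_at_most_mono[of f A _ k _ "Suc k"]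
    by (meson le_SucI order_refl)
qed

lemma decreasing_rearrangement_le_add:
  assumes "vanishing f A" "vanishing g B" "0 \<le> e"
    and "\<And>t. 0 \<le> t \<Longrightarrow> exceed_at_most f A t k \<Longrightarrow> exceed_at_most g B (t + e) k"
  shows "decreasing_rearrangement g B k \<le> decreasing_rearrangement f A k + e"
  using decreasing_rearrangement_le_iff[OF assms(1), of k "decreasing_rearrangement f A k"]
    decreasing_rearrangement_le_iff[OF assms(2)] assms(3,4) by auto

text \<open>Moving every entry by at most \<open>e\<close> moves the counts by at most \<open>e\<close> in the level, so ranking is a
  contraction for the supremum norm.\<close>

lemma abs_decreasing_rearrangement_diff_le:
  assumes "vanishing f A" "vanishing g A" "0 \<le> e" "\<And>i. i \<in> A \<Longrightarrow> \<bar>f i - g i\<bar> \<le> e"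
  shows "\<bar>decreasing_rearrangement f A k - decreasing_rearrangement g A k\<bar> \<le> e"
proof -
  have shift: "exceed_at_most h' A (t + e) k"
    if h: "\<And>i. i \<in> A \<Longrightarrow> \<bar>h i - h' i\<bar> \<le> e" and t: "exceed_at_most h A t k" for h h' t
    unfolding exceed_at_most_iff_subsets
  proof (intro allI impI)
    fix B assume B: "B \<subseteq> A" "finite B" "card B = Suc k"
    then obtain i where "i \<in> B" "h i \<le> t" using t unfolding exceed_at_most_iff_subsets by blast
    then show "\<exists>i\<in>B. h' i \<le> t + e" using h[of i] B by (intro bexI[of _ i]) auto
  qed
  have "decreasing_rearrangement g A k \<le> decreasing_rearrangement f A k + e"
    by (rule decreasing_rearrangement_le_add[OF assms(1-3)]) (rule shift[OF assms(4)])
  moreover have "decreasing_rearrangement f A k \<le> decreasing_rearrangement g A k + e"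
    using assms(4) by (intro decreasing_rearrangement_le_add[OF assms(2,1,3)])
      (rule shift[of g f], auto simp: abs_minus_commute)
  ultimately show ?thesis by simp
qed

lemma decreasing_rearrangement_reindex:
  assumes "bij_betw \<pi> A B" "\<And>i. i \<in> A \<Longrightarrow> g (\<pi> i) = f i"
  shows "decreasing_rearrangement f A = decreasing_rearrangement g B"
proof -
  have bij: "bij_betw \<pi> {i \<in> A. t < f i} {j \<in> B. t < g j}" for t
  proof (rule bij_betw_subset[OF assms(1)])
    show "\<pi> ` {i \<in> A. t < f i} = {j \<in> B. t < g j}"
      using assms(2) unfolding bij_betw_imp_surj_on[OF assms(1), symmetric] by auto
  qed auto
  have "exceed_at_most f A t k = exceed_at_most g B t k" for t k
    unfolding exceed_at_most_def using bij_betw_finite[OF bij] bij_betw_same_card[OF bij] by simp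
  then show ?thesis unfolding decreasing_rearrangement_alt fun_eq_iff by simp
qed

lemma vanishing_if_integrable:
  assumes fin: "(\<integral>\<^sup>+i. ennreal (f i) \<partial>count_space A) < \<infinity>"
  shows "vanishing f A"
  unfolding vanishing_def
proof (intro allI impI)
  fix t :: real assume t: "0 < t"
  have "ennreal t * emeasure (count_space A) {i \<in> A. t < f i}
      = (\<integral>\<^sup>+i. ennreal t * indicator {i \<in> A. t < f i} i \<partial>count_space A)"
    by (subst nn_integral_cmult_indicator) auto
  also have "\<dots> \<le> (\<integral>\<^sup>+i. ennreal (f i) \<partial>count_space A)"
    by (intro nn_integral_mono) (auto split: split_indicator intro!: ennreal_leI)
  finally have "ennreal t * emeasure (count_space A) {i \<in> A. t < f i} < \<infinity>"
    using fin by (rule le_less_trans)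
  then show "finite {i \<in> A. t < f i}"
    using t by (auto simp: emeasure_count_space ennreal_mult_eq_top_iff ennreal_mult_top split: if_splits)
qed

text \<open>The sum of a non-negative family depends only on its counts above positive levels. Ranking
  preserves these counts, hence it preserves the sum.\<close>

lemma layer_cake_count:
  assumes "countable A" "\<And>i. i \<in> A \<Longrightarrow> 0 \<le> f i"
  shows "(\<integral>\<^sup>+i. ennreal (f i) \<partial>count_space A)
    = (\<integral>\<^sup>+t. indicator {0<..} t * emeasure (count_space A) {i \<in> A. t < f i} \<partial>lborel)"
proof -
  have "(\<integral>\<^sup>+i. ennreal (f i) \<partial>count_space A)
      = (\<integral>\<^sup>+i. \<integral>\<^sup>+t. indicator {0<..<f i} t \<partial>lborel \<partial>count_space A)"
    using assms(2) by (intro nn_integral_cong) simp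
  also have "\<dots> = (\<integral>\<^sup>+t. \<integral>\<^sup>+i. indicator {0<..<f i} t \<partial>count_space A \<partial>lborel)"
    by (rule nn_integral_count_space_nn_integral[symmetric, OF assms(1)]) simp
  also have "\<dots> = (\<integral>\<^sup>+t. \<integral>\<^sup>+i. indicator {0<..} t * indicator {i \<in> A. t < f i} i \<partial>count_space A \<partial>lborel)"
    by (intro nn_integral_cong) (auto split: split_indicator)
  also have "\<dots> = (\<integral>\<^sup>+t. indicator {0<..} t * emeasure (count_space A) {i \<in> A. t < f i} \<partial>lborel)"
    by (intro nn_integral_cong) (simp add: nn_integral_cmult)
  finally show ?thesis .
qed

lemma decreasing_rearrangement_in_nabla:
  assumes "countable A" "\<And>i. i \<in> A \<Longrightarrow> 0 \<le> f i"
    and one: "(\<integral>\<^sup>+i. ennreal (f i) \<partial>count_space A) = 1"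
  shows "decreasing_rearrangement f A \<in> nabla"
proof -
  let ?x = "decreasing_rearrangement f A"
  have v: "vanishing f A" using one by (intro vanishing_if_integrable) simp
  note nonneg = decreasing_rearrangement_nonneg[OF v]
  have count: "emeasure (count_space UNIV) {k. t < ?x k} = emeasure (count_space A) {i \<in> A. t < f i}"
    if t: "0 < t" for t
  proof -
    have fin: "finite {i \<in> A. t < f i}" using v t unfolding vanishing_def by simp
    have "{k. t < ?x k} = {..<card {i \<in> A. t < f i}}"
      using decreasing_rearrangement_le_iff[OF v, of _ t] fin t
      unfolding exceed_at_most_def set_eq_iff mem_Collect_eq lessThan_iff not_le[symmetric] by simp
    then show ?thesis using fin by (simp add: emeasure_count_space)
  qed
  have "(\<integral>\<^sup>+k. ennreal (?x k) \<partial>count_space UNIV)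
      = (\<integral>\<^sup>+t. indicator {0<..} t * emeasure (count_space UNIV) {k \<in> UNIV. t < ?x k} \<partial>lborel)"
    using nonneg by (intro layer_cake_count) auto
  also have "\<dots> = (\<integral>\<^sup>+t. indicator {0<..} t * emeasure (count_space A) {i \<in> A. t < f i} \<partial>lborel)"
    using count by (intro nn_integral_cong) (auto split: split_indicator)
  also have "\<dots> = 1" using layer_cake_count[OF assms(1,2)] one by simp
  finally have "(\<Sum>k. ennreal (?x k)) = ennreal 1"
    by (simp add: nn_integral_count_space_nat)
  then have "(\<lambda>k. ennreal (?x k)) sums ennreal 1"
    using summable_sums[of "\<lambda>k. ennreal (?x k)"] by simp
  then have "?x sums 1"
    by (rule sums_ennreal[THEN iffD1, rotated 2]) (use nonneg in simp_all)
  then show ?thesis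
    unfolding nabla_def using nonneg decseq_decreasing_rearrangement[OF v] by simp
qed

text \<open>At parameters where more than \<open>k\<close> entries exceed every level, the value is the infimum of the empty
  set; this constant is the second branch of the case distinction.\<close>

lemma borel_measurable_decreasing_rearrangement:
  fixes f :: "'a \<Rightarrow> nat \<Rightarrow> real"
  assumes [measurable]: "\<And>i. (\<lambda>w. f w i) \<in> borel_measurable M"
  shows "(\<lambda>w. decreasing_rearrangement (f w) UNIV k) \<in> borel_measurable M"
proof -
  define \<B> where "\<B> = {B :: nat set. finite B \<and> card B = Suc k}"
  have \<B>: "countable \<B>"
    by (rule countable_subset[OF _ countable_Collect_finite]) (auto simp: \<B>_def)
  have ex: "exceed_at_most (f w) UNIV t k \<longleftrightarrow> (\<forall>B\<in>\<B>. \<exists>i\<in>B. f w i \<le> t)" for w t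
    unfolding exceed_at_most_iff_subsets \<B>_def by auto
  have m [measurable]: "Measurable.pred M (\<lambda>w. exceed_at_most (f w) UNIV t k)" for t
    unfolding ex using \<B> by measurable
  have le: "decreasing_rearrangement (f w) UNIV k \<le> a \<longleftrightarrow>
     (if \<exists>n. exceed_at_most (f w) UNIV (real n) k then 0 \<le> a \<and> exceed_at_most (f w) UNIV a k
      else Inf {} \<le> a)" for w a
  proof (cases "\<exists>n. exceed_at_most (f w) UNIV (real n) k")
    case True
    then show ?thesis using decreasing_rearrangement_le_iff'[of "real _" "f w"] by auto
  next
    case False
    then have "\<not> exceed_at_most (f w) UNIV t k" for t
      using exceed_at_most_mono[of "f w" UNIV t k "real (nat \<lceil>t\<rceil>)" k] by (auto simp: real_nat_ceiling_ge)
    then show ?thesis using False unfolding decreasing_rearrangement_alt by simp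
  qed
  show ?thesis unfolding borel_measurable_iff_le le by measurable
qed

lemma borel_measurable_decreasing_rearrangement_seq:
  fixes f :: "'a \<Rightarrow> nat \<Rightarrow> real"
  assumes "\<And>i. (\<lambda>w. f w i) \<in> borel_measurable M"
  shows "(\<lambda>w. decreasing_rearrangement (f w) UNIV) \<in> M \<rightarrow>\<^sub>M borel"
  using assms by (intro measurable_coordinatewise_then_product borel_measurable_decreasing_rearrangement)

lemma sets_Collect_ranked_mass_1:
  fixes X :: "nat \<Rightarrow> 'b \<Rightarrow> real"
  assumes X [measurable]: "\<And>i. X i \<in> borel_measurable M"
  shows "{w \<in> space M. (\<forall>i. X (Suc i) w \<le> X i w) \<and> (\<forall>i. 0 \<le> X i w) \<and>
      (\<forall>m::nat. \<exists>N. \<forall>n\<ge>N. \<bar>(\<Sum>i<n. X i w) - 1\<bar> < 1 / real (Suc m))} \<in> sets M"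
proof -
  have [measurable]: "Measurable.pred M (\<lambda>w. X (Suc i) w \<le> X i w)" for i
    using borel_measurable_le[OF X X, of "Suc i" i] by simp
  have [measurable]: "Measurable.pred M (\<lambda>w. \<bar>(\<Sum>i<n. X i w) - 1\<bar> < 1 / real (Suc m))" for m n
    by measurable
  show ?thesis by measurable
qed

lemma nabla_borel: "nabla \<in> sets borel"
proof -
  have inv: "(\<forall>r>0. P r) \<longleftrightarrow> (\<forall>m::nat. P (1 / real (Suc m)))"
    if "\<And>r s. P r \<Longrightarrow> r < s \<Longrightarrow> P s" for P
    using that by (metis nat_approx_posE of_nat_0_less_iff zero_less_Suc zero_less_divide_1_iff)
  have "(\<forall>r>0. \<exists>N. \<forall>n\<ge>N. \<bar>(\<Sum>i<n. x i) - 1\<bar> < r) \<longleftrightarrow>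
      (\<forall>m::nat. \<exists>N. \<forall>n\<ge>N. \<bar>(\<Sum>i<n. x i) - 1\<bar> < 1 / real (Suc m))" for x :: "nat \<Rightarrow> real"
    by (rule inv) (meson order_less_trans)
  then have eq: "nabla = {x \<in> space borel. (\<forall>i. x (Suc i) \<le> x i) \<and> (\<forall>i. 0 \<le> x i) \<and>
      (\<forall>m::nat. \<exists>N. \<forall>n\<ge>N. \<bar>(\<Sum>i<n. x i) - 1\<bar> < 1 / real (Suc m))}"
    unfolding nabla_def sums_def LIMSEQ_def decseq_Suc_iff dist_real_def by simp
  show ?thesis
    using sets_Collect_ranked_mass_1[of "\<lambda>i x. x i" borel]
    unfolding eq by (simp add: measurable_product_coordinates)
qed

section \<open>Ranked lengths of interval partitions\<close>

lemma interval_partition_obtain: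
  assumes "\<gamma> \<in> IH" "U \<in> \<gamma>"
  obtains a b where "0 \<le> a" "a < b" "b \<le> total_mass \<gamma>" "U = {a<..<b}"
    "a \<in> gap_set \<gamma>" "b \<in> gap_set \<gamma>" "measure lborel U = b - a"
proof -
  have ip: "interval_partition (total_mass \<gamma>) \<gamma>" by (rule gap_set_props(5)[OF assms(1)])
  then obtain a b where ab: "0 \<le> a" "a < b" "b \<le> total_mass \<gamma>" "U = {a<..<b}"
    using assms(2) unfolding interval_partition_def by blast
  moreover have "a \<in> gap_set \<gamma>" "b \<in> gap_set \<gamma>"
    using interval_partition_endpoints[OF ip, of a b] assms(2) ab unfolding gap_set_def by auto
  moreover have "measure lborel U = b - a" using ab by simp
  ultimately show ?thesis using that by blast
qed

lemma interval_partition_total_length: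
  assumes "\<gamma> \<in> IH"
  shows "countable \<gamma>" "(\<integral>\<^sup>+U. ennreal (measure lborel U) \<partial>count_space \<gamma>) = ennreal (total_mass \<gamma>)"
proof -
  have ip: "interval_partition (total_mass \<gamma>) \<gamma>" by (rule gap_set_props(5)[OF assms])
  have opn: "open U" if "U \<in> \<gamma>" for U
    using interval_partition_obtain[OF assms that] by (metis open_greaterThanLessThan)
  have disj: "disjoint \<gamma>" using ip unfolding interval_partition_def by blast
  show cnt: "countable \<gamma>"
    by (rule countable_disjoint_open_subsets[OF _ disj]) (use opn in blast)
  have em: "emeasure lborel U = ennreal (measure lborel U)" if U: "U \<in> \<gamma>" for U
    by (rule interval_partition_obtain[OF assms U]) simp
  have "(\<integral>\<^sup>+U. ennreal (measure lborel U) \<partial>count_space \<gamma>) = (\<integral>\<^sup>+U. emeasure lborel U \<partial>count_space \<gamma>)"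
    using em by (intro nn_integral_cong) simp
  also have "\<dots> = emeasure lborel (\<Union>U\<in>\<gamma>. U)"
    using opn disj
    by (intro emeasure_UN_countable[symmetric] cnt)
      (auto simp: disjoint_family_on_def disjoint_def)
  also have "\<dots> = emeasure lborel ({0..total_mass \<gamma>} - gap_set \<gamma>)"
    using gap_set_props(6)[OF assms] by simp
  also have "\<dots> = emeasure lborel {0..total_mass \<gamma>}"
    using ip unfolding gap_set_def interval_partition_def by (intro emeasure_Diff_null_set) auto
  also have "\<dots> = ennreal (total_mass \<gamma>)" using ip unfolding interval_partition_def by simp
  finally show "(\<integral>\<^sup>+U. ennreal (measure lborel U) \<partial>count_space \<gamma>) = ennreal (total_mass \<gamma>)" .
qed

lemma vanishing_interval_lengths: "\<gamma> \<in> IH \<Longrightarrow> vanishing (measure lborel) \<gamma>"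
  by (rule vanishing_if_integrable) (simp add: interval_partition_total_length(2))

lemma ranked_lengths_in_nabla:
  assumes "\<gamma> \<in> IH1"
  shows "ranked_lengths \<gamma> \<in> nabla"
proof -
  have IH: "\<gamma> \<in> IH" using assms unfolding IH_def IH1_def by blast
  have "total_mass \<gamma> = 1" using assms interval_partition_mass unfolding IH1_def by blast
  then show ?thesis
    unfolding ranked_lengths_def using interval_partition_total_length[OF IH]
    by (intro decreasing_rearrangement_in_nabla) simp_all
qed

lemma gap_set_near:
  assumes "\<gamma> \<in> IH" "\<gamma>' \<in> IH" "x \<in> gap_set \<gamma>'"
  obtains y where "y \<in> gap_set \<gamma>" "\<bar>x - y\<bar> \<le> d_H \<gamma> \<gamma>'"
proof -
  note c = gap_set_props(1)[OF assms(1)] gap_set_props(1)[OF assms(2)]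
  have ne: "gap_set \<gamma> \<noteq> {}" "gap_set \<gamma>' \<noteq> {}"
    using gap_set_props(2)[OF assms(1)] gap_set_props(2)[OF assms(2)] by auto
  have "infdist x (gap_set \<gamma>) \<le> d_H \<gamma> \<gamma>'"
    using hausdorff_distance_le_iff[OF c ne, of "d_H \<gamma> \<gamma>'"] assms(3) unfolding d_H_def by simp
  moreover obtain y where "y \<in> gap_set \<gamma>" "infdist x (gap_set \<gamma>) = dist x y"
    using infdist_attains_inf[OF compact_imp_closed[OF c(1)] ne(1)] by blast
  ultimately show ?thesis using that by (simp add: dist_real_def)
qed

text \<open>Let \<open>e\<close> be the Hausdorff distance. The midpoint of an interval of \<open>\<gamma>'\<close> longer than \<open>2 e\<close> lies in an interval
  of \<open>\<gamma>\<close> which loses at most \<open>2 e\<close> in length. Two such intervals of \<open>\<gamma>'\<close> never share their partner, since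
  a point of the complement of \<open>\<gamma>\<close> lies close to the end point between them. So \<open>\<gamma>\<close> has at least as many
  long intervals as \<open>\<gamma>'\<close>.\<close>

lemma exceed_at_most_d_H:
  assumes IH: "\<gamma> \<in> IH" "\<gamma>' \<in> IH" and t: "0 \<le> t"
    and few: "exceed_at_most (measure lborel) \<gamma> t k"
  shows "exceed_at_most (measure lborel) \<gamma>' (t + 2 * d_H \<gamma> \<gamma>') k"
proof -
  define e where "e = d_H \<gamma> \<gamma>'"
  define big where "big = {V \<in> \<gamma>'. t + 2 * e < measure lborel V}"
  have "\<exists>U. U \<in> \<gamma> \<and> t < measure lborel U \<and>
      (\<exists>a b. V = {a<..<b} \<and> b \<in> gap_set \<gamma>' \<and> 2 * e < b - a \<and> (a + b) / 2 \<in> U)" if V: "V \<in> big" for V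
  proof -
    have V': "V \<in> \<gamma>'" and len: "t + 2 * e < measure lborel V" using V unfolding big_def by auto
    obtain a b where ab: "0 \<le> a" "a < b" "V = {a<..<b}" "a \<in> gap_set \<gamma>'" "b \<in> gap_set \<gamma>'"
      "measure lborel V = b - a"
      by (rule interval_partition_obtain[OF IH(2) V'])
    \<comment> \<open>no point of the complement of \<open>\<gamma>\<close> lies deeper than \<open>e\<close> inside \<open>V\<close>\<close>
    have no_gap: "x \<notin> gap_set \<gamma>" if x: "a + e < x" "x < b - e" for x
    proof
      assume "x \<in> gap_set \<gamma>"
      then obtain y where y: "y \<in> gap_set \<gamma>'" "\<bar>x - y\<bar> \<le> d_H \<gamma>' \<gamma>"
        by (rule gap_set_near[OF IH(2,1)])
      moreover have "d_H \<gamma>' \<gamma> = e"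
        unfolding e_def using Metric_space.commute[OF Metric_space_IH] by blast
      ultimately have "y \<in> V" using x ab by auto
      then show False using y(1) V' unfolding gap_set_def by blast
    qed
    obtain g where g: "g \<in> gap_set \<gamma>" "\<bar>b - g\<bar> \<le> e"
      unfolding e_def by (rule gap_set_near[OF IH ab(5)])
    have mid: "a + e < (a + b) / 2" "(a + b) / 2 < b - e" using len ab(6) t by (auto simp: field_simps)
    have "g \<le> total_mass \<gamma>" "b - e \<le> g" using g gap_set_props(4)[OF IH(1)] by auto
    then have "(a + b) / 2 \<in> {0..total_mass \<gamma>}" using mid ab(1,2) by auto
    then have "(a + b) / 2 \<in> \<Union>\<gamma>"
      using no_gap[OF mid] gap_set_props(6)[OF IH(1)] by blast
    then obtain U where U: "U \<in> \<gamma>" "(a + b) / 2 \<in> U" by blast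
    obtain c d where cd: "U = {c<..<d}" "c \<in> gap_set \<gamma>" "d \<in> gap_set \<gamma>" "measure lborel U = d - c"
      by (rule interval_partition_obtain[OF IH(1) U(1)])
    have "c \<le> a + e" "b - e \<le> d"
      using no_gap[of c] no_gap[of d] cd U mid by (auto simp: not_less[symmetric])
    then have "t < measure lborel U" using cd(4) len ab(6) by simp
    moreover have "2 * e < b - a" using len ab(6) t by simp
    ultimately show ?thesis using U ab(3,5) by blast
  qed
  then obtain \<phi> where \<phi>: "\<And>V. V \<in> big \<Longrightarrow> \<phi> V \<in> \<gamma> \<and> t < measure lborel (\<phi> V) \<and>
      (\<exists>a b. V = {a<..<b} \<and> b \<in> gap_set \<gamma>' \<and> 2 * e < b - a \<and> (a + b) / 2 \<in> \<phi> V)"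
    by metis
  \<comment> \<open>between the midpoints of two large intervals there is a point of the complement of \<open>\<gamma>\<close>\<close>
  have sep: False
    if U: "U \<in> \<gamma>" and b: "b \<in> gap_set \<gamma>'" "2 * e < b - a" "2 * e < b' - a'" "b \<le> a'"
      and mid: "(a + b) / 2 \<in> U" "(a' + b') / 2 \<in> U" for U a b a' b'
  proof -
    obtain g where g: "g \<in> gap_set \<gamma>" "\<bar>b - g\<bar> \<le> e"
      unfolding e_def by (rule gap_set_near[OF IH b(1)])
    obtain c d where cd: "U = {c<..<d}" by (rule interval_partition_obtain[OF IH(1) U])
    have "(a + b) / 2 < g" "g < (a' + b') / 2" using g(2) b by (auto simp: field_simps abs_le_iff)
    then have "g \<in> U" using mid cd by auto
    then show False using g(1) U unfolding gap_set_def by blast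
  qed
  have inj: "inj_on \<phi> big"
  proof (rule inj_onI)
    fix V V' assume V: "V \<in> big" "V' \<in> big" and eq: "\<phi> V = \<phi> V'"
    obtain a b where ab: "V = {a<..<b}" "b \<in> gap_set \<gamma>'" "2 * e < b - a" "(a + b) / 2 \<in> \<phi> V"
      using \<phi>[OF V(1)] by blast
    obtain a' b' where ab': "V' = {a'<..<b'}" "b' \<in> gap_set \<gamma>'" "2 * e < b' - a'" "(a' + b') / 2 \<in> \<phi> V'"
      using \<phi>[OF V(2)] by blast
    have nb: "\<not> b \<le> a'" "\<not> b' \<le> a"
      using sep[of "\<phi> V" b a b' a'] sep[of "\<phi> V" b' a' b a] \<phi>[OF V(1)] ab ab' eq by auto
    show "V = V'"
    proof (rule ccontr)
      assume "V \<noteq> V'"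
      then have disj: "V \<inter> V' = {}"
        using V gap_set_props(5)[OF IH(2)] unfolding big_def interval_partition_def disjoint_def by blast
      have "0 \<le> e" unfolding e_def using Metric_space.nonneg[OF Metric_space_IH] by blast
      then have "max a a' < min b b'" using nb ab(3) ab'(3) by auto
      then obtain x where "max a a' < x" "x < min b b'" using dense by blast
      then show False using disj ab(1) ab'(1) by auto
    qed
  qed
  have sub: "\<phi> ` big \<subseteq> {U \<in> \<gamma>. t < measure lborel U}" using \<phi> by blast
  have fin: "finite {U \<in> \<gamma>. t < measure lborel U}" and card: "card {U \<in> \<gamma>. t < measure lborel U} \<le> k"
    using few unfolding exceed_at_most_def by auto
  have "finite big" using finite_subset[OF sub fin] inj by (rule finite_imageD)
  moreover have "card big \<le> k" using card_mono[OF fin sub] card card_image[OF inj] by simp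
  ultimately show ?thesis unfolding exceed_at_most_def big_def e_def by simp
qed

lemma ranked_lengths_Lipschitz:
  assumes "\<gamma> \<in> IH" "\<gamma>' \<in> IH"
  shows "\<bar>ranked_lengths \<gamma> k - ranked_lengths \<gamma>' k\<bar> \<le> 2 * d_H \<gamma> \<gamma>'"
proof -
  have le: "ranked_lengths \<delta>' k \<le> ranked_lengths \<delta> k + 2 * d_H \<delta> \<delta>'"
    if "\<delta> \<in> IH" "\<delta>' \<in> IH" for \<delta> \<delta>'
    unfolding ranked_lengths_def
    using Metric_space.nonneg[OF Metric_space_IH, of \<delta> \<delta>']
    by (intro decreasing_rearrangement_le_add vanishing_interval_lengths that exceed_at_most_d_H) auto
  have "d_H \<gamma>' \<gamma> = d_H \<gamma> \<gamma>'" using Metric_space.commute[OF Metric_space_IH] by blast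
  then show ?thesis using le[OF assms] le[OF assms(2,1)] by (simp add: abs_le_iff)
qed

lemma space_borel_IH1: "space borel_IH1 = IH1"
  unfolding borel_IH1_def by (rule space_measure_of_conv)

text \<open>By the Lipschitz bound the ranked lengths are continuous for \<open>d_H\<close>, so each set on which one of them
  exceeds a level is open.\<close>

lemma measurable_ranked_lengths: "ranked_lengths \<in> borel_IH1 \<rightarrow>\<^sub>M borel_nabla"
proof -
  interpret Metric_space IH1 d_H by (rule Metric_space_IH1)
  have sub: "IH1 \<subseteq> IH" unfolding IH_def IH1_def by blast
  have open_sets: "U \<in> sets borel_IH1" if "openin mtopology U" for U
  proof -
    have "{U. openin mtopology U} \<subseteq> Pow IH1" using openin_subset[of mtopology] by auto
    then show ?thesis using that unfolding borel_IH1_def by (auto simp: sets_measure_of)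
  qed
  have "(\<lambda>\<gamma>. ranked_lengths \<gamma> k) \<in> borel_measurable borel_IH1" for k
    unfolding borel_measurable_iff_greater
  proof
    fix s
    have "openin mtopology {\<gamma> \<in> IH1. s < ranked_lengths \<gamma> k}"
      unfolding openin_mtopology
    proof (intro conjI allI impI)
      fix \<gamma> assume "\<gamma> \<in> {\<gamma> \<in> IH1. s < ranked_lengths \<gamma> k}"
      then have \<gamma>: "\<gamma> \<in> IH1" "s < ranked_lengths \<gamma> k" by auto
      define r where "r = (ranked_lengths \<gamma> k - s) / 2"
      have "\<delta> \<in> {\<gamma> \<in> IH1. s < ranked_lengths \<gamma> k}" if "\<delta> \<in> mball \<gamma> r" for \<delta>
      proof -
        have \<delta>: "\<delta> \<in> IH1" "d_H \<gamma> \<delta> < r" using that by auto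
        then have "\<gamma> \<in> IH" "\<delta> \<in> IH" using \<gamma> sub by auto
        then show ?thesis using ranked_lengths_Lipschitz[of \<gamma> \<delta> k] \<delta> by (auto simp: r_def)
      qed
      then show "\<exists>r>0. mball \<gamma> r \<subseteq> {\<gamma> \<in> IH1. s < ranked_lengths \<gamma> k}"
        using \<gamma> by (intro exI[of _ r]) (auto simp: r_def)
    qed auto
    then show "{w \<in> space borel_IH1. s < ranked_lengths w k} \<in> sets borel_IH1"
      using open_sets by (simp add: space_borel_IH1)
  qed
  then show ?thesis
    unfolding borel_nabla_def
    by (intro measurable_restrict_space2 measurable_coordinatewise_then_product)
      (auto simp: space_borel_IH1 ranked_lengths_in_nabla)
qed

section \<open>Compositions as interval partitions\<close>

definition compositions :: "nat \<Rightarrow> nat list set" where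
  "compositions n = {c. (\<forall>m\<in>set c. 1 \<le> m) \<and> sum_list c = n}"

text \<open>Padding with zeros gives all compositions the same index set, so that fractions of different
  compositions can be compared entry by entry.\<close>

definition table_fraction :: "nat list \<Rightarrow> nat \<Rightarrow> real" where
  "table_fraction c i = (if i < length c then real (c ! i) / real (sum_list c) else 0)"

lemma vanishing_table_fraction: "vanishing (table_fraction c) A"
proof -
  have "{i \<in> A. t < table_fraction c i} \<subseteq> {..<length c}" if "0 < t" for t
    using that by (auto simp: table_fraction_def split: if_splits)
  then show ?thesis unfolding vanishing_def using finite_subset by blast
qed

lemma decreasing_rearrangement_table_fraction_cong:
  assumes "mset c = mset c'"
  shows "decreasing_rearrangement (table_fraction c) UNIV = decreasing_rearrangement (table_fraction c') UNIV"
proof -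
  obtain p where p: "p permutes {..<length c'}" "permute_list p c' = c"
    using mset_eq_permutation[OF assms] by blast
  have len: "length c = length c'" "sum_list c = sum_list c'"
    using assms by (metis size_mset, metis sum_mset_sum_list)
  have "table_fraction c' (p i) = table_fraction c i" for i
    using permute_list_nth[OF p(1), of i] p permutes_in_image[OF p(1), of i] len
    by (auto simp: table_fraction_def)
  then show ?thesis
    by (intro decreasing_rearrangement_reindex[of p]) (auto intro: permutes_bij[OF p(1)])
qed

text \<open>The points \<open>s i\<close> are the end points of the intervals of the rescaled composition.\<close>

context
  fixes c :: "nat list" and n :: nat and s :: "nat \<Rightarrow> real"
  assumes c: "c \<in> compositions n" and n: "1 \<le> n"
  defines "s \<equiv> \<lambda>i. real (sum_list (take i c)) / real n"
begin

lemma cut_Suc: "i < length c \<Longrightarrow> s (Suc i) = s i + table_fraction c i"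
  using c by (simp add: s_def take_Suc_conv_app_nth table_fraction_def compositions_def add_divide_distrib)

lemma cut_less_Suc: "i < length c \<Longrightarrow> s i < s (Suc i)"
proof -
  assume i: "i < length c"
  then have "1 \<le> c ! i" using c nth_mem unfolding compositions_def by blast
  then have "0 < real (c ! i)" by linarith
  then have "0 < table_fraction c i" using i c n by (simp add: table_fraction_def compositions_def)
  then show "s i < s (Suc i)" using cut_Suc[OF i] by simp
qed

lemma cut_mono: "i \<le> j \<Longrightarrow> j \<le> length c \<Longrightarrow> s i \<le> s j"
proof (induction rule: dec_induct)
  case (step m)
  then show ?case using cut_less_Suc[of m] by simp
qed simp

lemma cut_0: "s 0 = 0" and cut_length: "s (length c) = 1"
  using c n by (auto simp: s_def compositions_def)

lemma scaled_composition_partition: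
  "scale (1 / real n) (composition_partition c) = (\<lambda>i. {s i<..<s (Suc i)}) ` {..<length c}"
proof -
  have inj: "a = a' \<and> b = b'" if "{a<..<b} = {a'<..<b'}" "a < b" "a' < b'" for a b a' b' :: real
    using that by (metis cInf_greaterThanLessThan cSup_greaterThanLessThan)
  have "scale (1 / real n) (composition_partition c)
      = {{1 / real n * a<..<1 / real n * b} | a b. a < b \<and>
          (\<exists>i<length c. a = real n * s i \<and> b = real n * s (Suc i))}"
    (is "_ = {_ | a b. ?R a b}")
  proof -
    have s: "real (sum_list (take i c)) = real n * s i" for i using n by (simp add: s_def)
    have "(a < b \<and> {a<..<b} \<in> composition_partition c) \<longleftrightarrow> ?R a b" for a b
    proof -
      have "{a<..<b} = {real n * s i<..<real n * s (Suc i)} \<longleftrightarrow> a = real n * s i \<and> b = real n * s (Suc i)"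
        if "i < length c" "a < b" for i
        using inj[of a b "real n * s i" "real n * s (Suc i)"] that cut_less_Suc[OF that(1)] n by auto
      then show ?thesis unfolding composition_partition_def s by blast
    qed
    then show ?thesis unfolding scale_def by simp
  qed
  also have "\<dots> = (\<lambda>i. {s i<..<s (Suc i)}) ` {..<length c}"
  proof (intro equalityI subsetI)
    fix V assume "V \<in> (\<lambda>i. {s i<..<s (Suc i)}) ` {..<length c}"
    then obtain i where i: "i < length c" "V = {s i<..<s (Suc i)}" by auto
    then show "V \<in> {{1 / real n * a<..<1 / real n * b} | a b. ?R a b}"
      using n cut_less_Suc[OF i(1)]
      by (intro CollectI exI[of _ "real n * s i"] exI[of _ "real n * s (Suc i)"]) auto
  qed (use n in auto)
  finally show ?thesis .
qed

lemma cuts_disjoint: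
  assumes "i < length c" "j < length c" "i \<noteq> j"
  shows "{s i<..<s (Suc i)} \<inter> {s j<..<s (Suc j)} = {}"
proof (cases "i < j")
  case True
  then show ?thesis using cut_mono[of "Suc i" j] assms by auto
next
  case False
  then show ?thesis using cut_mono[of "Suc j" i] assms by auto
qed

lemma interval_partition_scaled_composition:
  "scale (1 / real n) (composition_partition c) \<in> IH1"
proof -
  let ?\<gamma> = "(\<lambda>i. {s i<..<s (Suc i)}) ` {..<length c}"
  have "\<exists>i<k. s i \<le> x \<and> x \<le> s (Suc i)" if "s 0 \<le> x" "x \<le> s k" "0 < k" for x k
    using that
  proof (induction k)
    case (Suc k)
    then show ?case by (cases "x \<le> s k"; cases k) (auto intro: less_SucI)
  qed simp
  moreover have "0 < length c" using cut_0 cut_length by (cases "length c") auto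
  ultimately have between: "\<exists>i<length c. s i \<le> x \<and> x \<le> s (Suc i)" if "x \<in> {0..1}" for x
    using that cut_0 cut_length by simp
  have "{0..1} - \<Union>?\<gamma> \<subseteq> s ` {..length c}"
  proof
    fix x assume x: "x \<in> {0..1} - \<Union>?\<gamma>"
    then obtain i where i: "i < length c" "s i \<le> x" "x \<le> s (Suc i)" using between by blast
    then have "x = s i \<or> x = s (Suc i)" using x by force
    then show "x \<in> s ` {..length c}" using i(1) by auto
  qed
  then have "{0..1} - \<Union>?\<gamma> \<in> null_sets lborel"
    by (rule null_sets_subset[rotated 2]) (auto intro!: finite_imp_null_set_lborel sets.Diff)
  moreover have "\<exists>a b. 0 \<le> a \<and> a < b \<and> b \<le> 1 \<and> {s i<..<s (Suc i)} = {a<..<b}"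
    if "i < length c" for i
    using cut_mono[of 0 i] cut_mono[of "Suc i" "length c"] cut_less_Suc[OF that] that
    unfolding cut_0 cut_length by auto
  moreover have "disjoint ?\<gamma>"
    using cuts_disjoint unfolding disjoint_def by blast
  ultimately show ?thesis
    unfolding IH1_def interval_partition_def scaled_composition_partition by auto
qed

lemma ranked_lengths_scaled_composition:
  "ranked_lengths (scale (1 / real n) (composition_partition c))
    = decreasing_rearrangement (table_fraction c) UNIV"
proof -
  have "inj_on (\<lambda>i. {s i<..<s (Suc i)}) {..<length c}"
  proof (rule inj_onI, rule ccontr)
    fix i j assume "i \<in> {..<length c}" "j \<in> {..<length c}" "{s i<..<s (Suc i)} = {s j<..<s (Suc j)}" "i \<noteq> j"
    then show False using cuts_disjoint[of i j] cut_less_Suc[of i] by auto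
  qed
  then have "bij_betw (\<lambda>i. {s i<..<s (Suc i)}) {..<length c} (scale (1 / real n) (composition_partition c))"
    unfolding scaled_composition_partition by (rule inj_on_imp_bij_betw)
  then have *: "decreasing_rearrangement (table_fraction c) {..<length c}
      = ranked_lengths (scale (1 / real n) (composition_partition c))"
    unfolding ranked_lengths_def
    by (rule decreasing_rearrangement_reindex) (use cut_Suc cut_less_Suc in \<open>auto simp: less_imp_le\<close>)
  have "{i \<in> {..<length c}. t < table_fraction c i} = {i \<in> UNIV. t < table_fraction c i}" if "0 \<le> t" for t
    using that by (auto simp: table_fraction_def split: if_splits)
  then have "decreasing_rearrangement (table_fraction c) {..<length c} = decreasing_rearrangement (table_fraction c) UNIV"
    unfolding decreasing_rearrangement_def fun_eq_iff by (simp cong: conj_cong)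
  with * show ?thesis by simp
qed

end

section \<open>Seating chains as averaging operators\<close>

text \<open>The expectation of \<open>F\<close> after one more customer has been seated according to \<open>p\<close>, starting from \<open>c\<close>.
  Iterating this operator gives expectations after \<open>n\<close> further customers, so auxiliary chains need no
  probability space of their own.\<close>

definition step :: "(nat list \<Rightarrow> seating \<Rightarrow> real) \<Rightarrow> (nat list \<Rightarrow> real) \<Rightarrow> nat list \<Rightarrow> real" where
  "step p F c = (\<Sum>s\<in>seatings c. p c s * F (seat c s))"

lemma finite_seatings: "finite (seatings c)"
  unfolding seatings_def by simp

lemma step_split:
  "step p F c = (\<Sum>i<length c. p c (Join i) * F (c[i := Suc (c ! i)]))
     + (\<Sum>j\<le>length c. p c (New j) * F (take j c @ [1] @ drop j c))"
  unfolding step_def seatings_def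
  by (subst sum.union_disjoint) (auto simp: sum.reindex inj_on_def)

lemma step_append:
  assumes "\<And>j. j < length c \<Longrightarrow> p c (New j) = 0"
  shows "step p F c = (\<Sum>i<length c. p c (Join i) * F (c[i := Suc (c ! i)]))
     + p c (New (length c)) * F (c @ [1])"
proof -
  have "(\<Sum>j\<le>length c. p c (New j) * F (take j c @ [1] @ drop j c)) = p c (New (length c)) * F (c @ [1])"
    using assms by (subst sum.remove[of _ "length c"]) (auto intro!: sum.neutral)
  then show ?thesis unfolding step_split by simp
qed

lemma sum_list_Suc_update:
  "i < length c \<Longrightarrow> sum_list (c[i := Suc (c ! i)]) = Suc (sum_list c)"
  by (induction c arbitrary: i) (auto split: nat.split)

lemma seat_compositions:
  assumes "c \<in> compositions n" "s \<in> seatings c"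
  shows "seat c s \<in> compositions (Suc n)"
proof (cases s)
  case (Join i)
  then have i: "i < length c" using assms(2) by (auto simp: seatings_def)
  have "set (c[i := Suc (c ! i)]) \<subseteq> insert (Suc (c ! i)) (set c)" by (rule set_update_subset_insert)
  then show ?thesis
    using assms(1) sum_list_Suc_update[OF i] Join unfolding compositions_def by auto
next
  case (New j)
  have "sum_list (take j c) + sum_list (drop j c) = sum_list c"
    by (metis append_take_drop_id sum_list_append)
  then show ?thesis
    using assms(1) New unfolding compositions_def
    by (auto dest: in_set_takeD in_set_dropD)
qed

lemma finite_compositions: "finite (compositions n)"
proof (rule finite_subset)
  have "length c \<le> sum_list c" if "\<forall>m\<in>set c. 1 \<le> m" for c :: "nat list"
    using that by (induction c) auto
  then show "compositions n \<subseteq> {c. set c \<subseteq> {..n} \<and> length c \<le> n}"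
    unfolding compositions_def using member_le_sum_list by auto
qed (rule finite_lists_length_le, simp)

lemma step_pow_Suc: "(step p ^^ Suc n) F c = (\<Sum>s\<in>seatings c. p c s * (step p ^^ n) F (seat c s))"
  by (simp add: step_def)

lemma step_pow_mono:
  assumes "\<And>c s. 0 \<le> p c s" "c \<in> compositions m"
    "\<And>c. c \<in> compositions (m + n) \<Longrightarrow> F c \<le> G c"
  shows "(step p ^^ n) F c \<le> (step p ^^ n) G c"
  using assms(2,3)
proof (induction n arbitrary: m c)
  case (Suc n)
  have "(step p ^^ n) F (seat c s) \<le> (step p ^^ n) G (seat c s)" if "s \<in> seatings c" for s
    using Suc.IH[OF seat_compositions[OF Suc.prems(1) that]] Suc.prems(2) by simp
  then show ?case unfolding step_pow_Suc by (intro sum_mono mult_left_mono assms(1))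
qed simp

lemma step_pow_cmult: "(step p ^^ n) (\<lambda>c. a * F c) c = a * (step p ^^ n) F c"
  by (induction n arbitrary: c) (simp_all add: step_def sum_distrib_left mult_ac)

lemma step_pow_add: "(step p ^^ n) (\<lambda>c. F c + G c) c = (step p ^^ n) F c + (step p ^^ n) G c"
  by (induction n arbitrary: c) (simp_all add: step_def sum.distrib algebra_simps)

lemma step_pow_diff: "(step p ^^ n) (\<lambda>c. F c - G c) c = (step p ^^ n) F c - (step p ^^ n) G c"
  using step_pow_add[of n p F "\<lambda>c. -1 * G c" c] step_pow_cmult[of n p "-1" G c] by simp

lemma step_pow_sum:
  "finite I \<Longrightarrow> (step p ^^ n) (\<lambda>c. \<Sum>i\<in>I. F i c) c = (\<Sum>i\<in>I. (step p ^^ n) (F i) c)"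
proof (induction I rule: finite_induct)
  case empty
  show ?case using step_pow_cmult[of n p 0 "\<lambda>_. 0" c] by simp
qed (simp add: step_pow_add)

lemma step_pow_const:
  assumes "\<And>c. (\<Sum>s\<in>seatings c. p c s) = 1"
  shows "(step p ^^ n) (\<lambda>_. a) c = a"
  by (induction n arbitrary: c) (simp_all add: step_def assms flip: sum_distrib_right)

section \<open>Expectations along the ordered Chinese restaurant process\<close>

context
  fixes \<alpha> \<theta>\<^sub>1 \<theta>\<^sub>2 :: real and M :: "'a measure" and C :: "nat \<Rightarrow> 'a \<Rightarrow> nat list"
  assumes oCRP: "is_oCRP \<alpha> \<theta>\<^sub>1 \<theta>\<^sub>2 M C"
begin

interpretation prob_space M using oCRP unfolding is_oCRP_def by blast

lemma sets_oCRP: "1 \<le> n \<Longrightarrow> {\<omega> \<in> space M. C n \<omega> = x} \<in> sets M"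
proof -
  assume n: "1 \<le> n"
  have "C n -` {x} \<inter> space M \<in> sets M"
    using n oCRP unfolding is_oCRP_def by (intro measurable_sets[of _ M "count_space UNIV"]) auto
  moreover have "{\<omega> \<in> space M. C n \<omega> = x} = C n -` {x} \<inter> space M" by auto
  ultimately show ?thesis by simp
qed

lemma sets_oCRP_path: "{\<omega> \<in> space M. \<forall>i\<in>{1..n}. C i \<omega> = c i} \<in> sets M"
  by (rule sets.sets_Collect_finite_All) (auto intro: sets_oCRP)

lemma oCRP_path:
  "1 \<le> n \<Longrightarrow> measure M {\<omega> \<in> space M. \<forall>i\<in>{1..Suc n}. C i \<omega> = c i}
     = measure M {\<omega> \<in> space M. \<forall>i\<in>{1..n}. C i \<omega> = c i} * oCRP_trans \<alpha> \<theta>\<^sub>1 \<theta>\<^sub>2 (c n) (c (Suc n))"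
  using oCRP unfolding is_oCRP_def by blast

text \<open>There are only countably many paths of a given length, so all paths through a transition of
  probability \<open>0\<close> can be discarded at once.\<close>

lemma AE_oCRP_trans_nonzero:
  assumes "1 \<le> n"
  shows "AE \<omega> in M. oCRP_trans \<alpha> \<theta>\<^sub>1 \<theta>\<^sub>2 (C n \<omega>) (C (Suc n) \<omega>) \<noteq> 0"
proof -
  have "AE \<omega> in M. \<forall>z :: nat list list. oCRP_trans \<alpha> \<theta>\<^sub>1 \<theta>\<^sub>2 (z ! n) (z ! Suc n) = 0 \<longrightarrow>
      \<not> (\<forall>i\<in>{1..Suc n}. C i \<omega> = z ! i)"
    unfolding AE_all_countable
  proof
    fix z :: "nat list list"
    show "AE \<omega> in M. oCRP_trans \<alpha> \<theta>\<^sub>1 \<theta>\<^sub>2 (z ! n) (z ! Suc n) = 0 \<longrightarrow>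
      \<not> (\<forall>i\<in>{1..Suc n}. C i \<omega> = z ! i)"
    proof (cases "oCRP_trans \<alpha> \<theta>\<^sub>1 \<theta>\<^sub>2 (z ! n) (z ! Suc n) = 0")
      case True
      then have "measure M {\<omega> \<in> space M. \<forall>i\<in>{1..Suc n}. C i \<omega> = z ! i} = 0"
        using oCRP_path[OF assms, of "\<lambda>i. z ! i"] by simp
      then have "AE \<omega> in M. \<not> (\<forall>i\<in>{1..Suc n}. C i \<omega> = z ! i)"
        by (intro AE_I[where N="{\<omega> \<in> space M. \<forall>i\<in>{1..Suc n}. C i \<omega> = z ! i}"])
          (use sets_oCRP_path[of "Suc n" "\<lambda>i. z ! i"] in \<open>auto simp: emeasure_eq_measure\<close>)
      then show ?thesis by eventually_elim simp
    qed simp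
  qed
  then show ?thesis
  proof eventually_elim
    case (elim \<omega>)
    show ?case
    proof
      assume 0: "oCRP_trans \<alpha> \<theta>\<^sub>1 \<theta>\<^sub>2 (C n \<omega>) (C (Suc n) \<omega>) = 0"
      define z where "z = map (\<lambda>i. C i \<omega>) [0..<Suc (Suc n)]"
      have "z ! i = C i \<omega>" if "i \<le> Suc n" for i
        using that unfolding z_def by (subst nth_map) (auto simp del: upt_Suc)
      then show False using elim[rule_format, of z] 0 by auto
    qed
  qed
qed

lemma AE_oCRP_compositions: "AE \<omega> in M. \<forall>n\<ge>1. C n \<omega> \<in> compositions n"
proof -
  have "AE \<omega> in M. C 1 \<omega> = [1]" using oCRP unfolding is_oCRP_def by blast
  moreover have "AE \<omega> in M. \<forall>n\<in>{1..}. oCRP_trans \<alpha> \<theta>\<^sub>1 \<theta>\<^sub>2 (C n \<omega>) (C (Suc n) \<omega>) \<noteq> 0"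
    by (subst AE_ball_countable) (auto intro: AE_oCRP_trans_nonzero)
  ultimately show ?thesis
  proof eventually_elim
    case (elim \<omega>)
    have "C n \<omega> \<in> compositions n" if "1 \<le> n" for n
      using that
    proof (induction n rule: dec_induct)
      case base
      then show ?case using elim(1) by (simp add: compositions_def)
    next
      case (step n)
      have "{s \<in> seatings (C n \<omega>). seat (C n \<omega>) s = C (Suc n) \<omega>} \<noteq> {}"
        using elim(2) step(1) unfolding oCRP_trans_def by (metis atLeast_iff sum.empty)
      then obtain s where "s \<in> seatings (C n \<omega>)" "seat (C n \<omega>) s = C (Suc n) \<omega>" by auto
      then show ?case using seat_compositions[OF step.IH] by metis
    qed
    then show ?case by blast
  qed
qed

text \<open>The Markov property is given for whole paths. Only finitely many paths of compositions lead to \<open>x\<close>, and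
  summing over them leaves a statement on two consecutive compositions.\<close>

lemma oCRP_transition:
  assumes n: "1 \<le> n"
  shows "measure M {\<omega> \<in> space M. C n \<omega> = x \<and> C (Suc n) \<omega> = y}
    = measure M {\<omega> \<in> space M. C n \<omega> = x} * oCRP_trans \<alpha> \<theta>\<^sub>1 \<theta>\<^sub>2 x y"
proof -
  define P where "P = {c \<in> PiE {1..n} compositions. c n = x}"
  define E where "E c = {\<omega> \<in> space M. \<forall>i\<in>{1..n}. C i \<omega> = c i}" for c
  have finP: "finite P" unfolding P_def
    by (rule finite_subset[OF _ finite_PiE[of "{1..n}" compositions]]) (auto simp: finite_compositions)
  have disj: "disjoint_family_on E P"
    unfolding disjoint_family_on_def
  proof (intro ballI impI)
    fix c d assume cd: "c \<in> P" "d \<in> P" "c \<noteq> d"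
    then obtain i where "i \<in> {1..n}" "c i \<noteq> d i"
      unfolding P_def by (metis (mono_tags, lifting) PiE_ext mem_Collect_eq)
    then show "E c \<inter> E d = {}" unfolding E_def by auto
  qed
  have part: "measure M {\<omega> \<in> space M. C n \<omega> = x \<and> Q \<omega>} = (\<Sum>c\<in>P. measure M (E c \<inter> {\<omega> \<in> space M. Q \<omega>}))"
    if Q: "{\<omega> \<in> space M. Q \<omega>} \<in> sets M" for Q
  proof -
    have "measure M {\<omega> \<in> space M. C n \<omega> = x \<and> Q \<omega>} = measure M (\<Union>c\<in>P. E c \<inter> {\<omega> \<in> space M. Q \<omega>})"
    proof (rule measure_eq_AE)
      show "AE \<omega> in M. (\<omega> \<in> {\<omega> \<in> space M. C n \<omega> = x \<and> Q \<omega>}) = (\<omega> \<in> (\<Union>c\<in>P. E c \<inter> {\<omega> \<in> space M. Q \<omega>}))"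
        using AE_oCRP_compositions
      proof eventually_elim
        case (elim \<omega>)
        have "restrict (\<lambda>i. C i \<omega>) {1..n} \<in> P" if "C n \<omega> = x"
          using elim that n unfolding P_def by auto
        moreover have "\<omega> \<in> E (restrict (\<lambda>i. C i \<omega>) {1..n})" if "\<omega> \<in> space M"
          using that unfolding E_def by simp
        moreover have "C n \<omega> = x" if "c \<in> P" "\<omega> \<in> E c" for c
          using that n unfolding P_def E_def by auto
        ultimately show ?case by blast
      qed
      show "{\<omega> \<in> space M. C n \<omega> = x \<and> Q \<omega>} \<in> sets M"
        by (intro sets.sets_Collect_conj sets_oCRP[OF n] Q)
      show "(\<Union>c\<in>P. E c \<inter> {\<omega> \<in> space M. Q \<omega>}) \<in> sets M"
        using Q finP sets_oCRP_path unfolding E_def by (intro sets.finite_UN) auto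
    qed
    also have "\<dots> = (\<Sum>c\<in>P. measure M (E c \<inter> {\<omega> \<in> space M. Q \<omega>}))"
      using disj Q finP sets_oCRP_path unfolding E_def
      by (intro finite_measure_finite_Union) (auto simp: disjoint_family_on_def)
    finally show ?thesis .
  qed
  have "measure M {\<omega> \<in> space M. C n \<omega> = x \<and> C (Suc n) \<omega> = y}
      = (\<Sum>c\<in>P. measure M (E c \<inter> {\<omega> \<in> space M. C (Suc n) \<omega> = y}))"
    by (rule part[OF sets_oCRP]) simp
  also have "\<dots> = (\<Sum>c\<in>P. measure M (E c) * oCRP_trans \<alpha> \<theta>\<^sub>1 \<theta>\<^sub>2 x y)"
  proof (intro sum.cong refl)
    fix c assume c: "c \<in> P"
    have eq: "E c \<inter> {\<omega> \<in> space M. C (Suc n) \<omega> = y}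
        = {\<omega> \<in> space M. \<forall>i\<in>{1..Suc n}. C i \<omega> = (c(Suc n := y)) i}"
      unfolding E_def atLeastAtMostSuc_conv[of 1 n, simplified] by auto
    have "E c = {\<omega> \<in> space M. \<forall>i\<in>{1..n}. C i \<omega> = (c(Suc n := y)) i}"
      unfolding E_def by auto
    then show "measure M (E c \<inter> {\<omega> \<in> space M. C (Suc n) \<omega> = y}) = measure M (E c) * oCRP_trans \<alpha> \<theta>\<^sub>1 \<theta>\<^sub>2 x y"
      unfolding eq using oCRP_path[OF n, of "c(Suc n := y)"] c by (simp add: P_def)
  qed
  also have "\<dots> = measure M {\<omega> \<in> space M. C n \<omega> = x} * oCRP_trans \<alpha> \<theta>\<^sub>1 \<theta>\<^sub>2 x y"
    using part[of "\<lambda>_. True"] sets_oCRP_path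
    by (simp add: E_def Int_absorb2 sum_distrib_right)
  finally show ?thesis .
qed

lemma expectation_oCRP_sum:
  assumes n: "1 \<le> n"
  shows "expectation (\<lambda>\<omega>. F (C n \<omega>)) = (\<Sum>x\<in>compositions n. measure M {\<omega> \<in> space M. C n \<omega> = x} * F x)"
proof -
  have "expectation (\<lambda>\<omega>. F (C n \<omega>))
      = expectation (\<lambda>\<omega>. \<Sum>x\<in>compositions n. indicator {\<omega> \<in> space M. C n \<omega> = x} \<omega> * F x)"
  proof (rule integral_cong_AE)
    have C: "C n \<in> M \<rightarrow>\<^sub>M count_space UNIV" using oCRP n unfolding is_oCRP_def by blast
    show "(\<lambda>\<omega>. F (C n \<omega>)) \<in> borel_measurable M"
      by (rule measurable_compose[OF C]) simp
    show "(\<lambda>\<omega>. \<Sum>x\<in>compositions n. indicator {\<omega> \<in> space M. C n \<omega> = x} \<omega> * F x) \<in> borel_measurable M"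
      using sets_oCRP[OF n] by (intro borel_measurable_sum borel_measurable_times) auto
    show "AE \<omega> in M. F (C n \<omega>) = (\<Sum>x\<in>compositions n. indicator {\<omega> \<in> space M. C n \<omega> = x} \<omega> * F x)"
      using AE_oCRP_compositions AE_space
    proof eventually_elim
      case (elim \<omega>)
      then have Cn: "C n \<omega> \<in> compositions n" using n by blast
      have "(\<Sum>x\<in>compositions n. indicator {\<omega> \<in> space M. C n \<omega> = x} \<omega> * F x)
          = (\<Sum>x\<in>compositions n. if x = C n \<omega> then F x else 0)"
        using elim by (intro sum.cong) auto
      then show ?case using Cn finite_compositions by simp
    qed
  qed
  also have "\<dots> = (\<Sum>x\<in>compositions n. measure M {\<omega> \<in> space M. C n \<omega> = x} * F x)"
    using sets_oCRP[OF n] by (subst Bochner_Integration.integral_sum) (auto simp: emeasure_eq_measure)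
  finally show ?thesis .
qed

lemma step_seating_prob_eq_trans:
  assumes "x \<in> compositions n"
  shows "step (seating_prob \<alpha> \<theta>\<^sub>1 \<theta>\<^sub>2) F x = (\<Sum>y\<in>compositions (Suc n). oCRP_trans \<alpha> \<theta>\<^sub>1 \<theta>\<^sub>2 x y * F y)"
proof -
  have "step (seating_prob \<alpha> \<theta>\<^sub>1 \<theta>\<^sub>2) F x
      = (\<Sum>y\<in>compositions (Suc n). \<Sum>s\<in>{s \<in> seatings x. seat x s = y}. seating_prob \<alpha> \<theta>\<^sub>1 \<theta>\<^sub>2 x s * F (seat x s))"
    unfolding step_def
    by (rule sum.group[symmetric]) (auto simp: finite_seatings finite_compositions seat_compositions[OF assms])
  also have "\<dots> = (\<Sum>y\<in>compositions (Suc n). oCRP_trans \<alpha> \<theta>\<^sub>1 \<theta>\<^sub>2 x y * F y)"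
    unfolding oCRP_trans_def sum_distrib_right by (intro sum.cong refl) auto
  finally show ?thesis .
qed

lemma expectation_oCRP_step:
  assumes n: "1 \<le> n"
  shows "expectation (\<lambda>\<omega>. F (C (Suc n) \<omega>)) = expectation (\<lambda>\<omega>. step (seating_prob \<alpha> \<theta>\<^sub>1 \<theta>\<^sub>2) F (C n \<omega>))"
proof -
  have marginal: "measure M {\<omega> \<in> space M. C (Suc n) \<omega> = y}
      = (\<Sum>x\<in>compositions n. measure M {\<omega> \<in> space M. C n \<omega> = x} * oCRP_trans \<alpha> \<theta>\<^sub>1 \<theta>\<^sub>2 x y)" for y
  proof -
    have "measure M {\<omega> \<in> space M. C (Suc n) \<omega> = y}
        = measure M (\<Union>x\<in>compositions n. {\<omega> \<in> space M. C n \<omega> = x \<and> C (Suc n) \<omega> = y})"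
    proof (rule measure_eq_AE)
      show "AE \<omega> in M. (\<omega> \<in> {\<omega> \<in> space M. C (Suc n) \<omega> = y})
          = (\<omega> \<in> (\<Union>x\<in>compositions n. {\<omega> \<in> space M. C n \<omega> = x \<and> C (Suc n) \<omega> = y}))"
        using AE_oCRP_compositions by eventually_elim (use n in auto)
      show "(\<Union>x\<in>compositions n. {\<omega> \<in> space M. C n \<omega> = x \<and> C (Suc n) \<omega> = y}) \<in> sets M"
        by (intro sets.finite_UN finite_compositions sets.sets_Collect_conj sets_oCRP n) simp
    qed (rule sets_oCRP, simp)
    also have "\<dots> = (\<Sum>x\<in>compositions n. measure M {\<omega> \<in> space M. C n \<omega> = x \<and> C (Suc n) \<omega> = y})"
    proof (rule finite_measure_finite_Union)
      show "(\<lambda>x. {\<omega> \<in> space M. C n \<omega> = x \<and> C (Suc n) \<omega> = y}) ` compositions n \<subseteq> sets M"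
        using n by (auto intro!: sets.sets_Collect_conj sets_oCRP)
    qed (auto simp: finite_compositions disjoint_family_on_def)
    finally show ?thesis unfolding oCRP_transition[OF n] .
  qed
  have "expectation (\<lambda>\<omega>. F (C (Suc n) \<omega>)) = (\<Sum>y\<in>compositions (Suc n). \<Sum>x\<in>compositions n.
      measure M {\<omega> \<in> space M. C n \<omega> = x} * oCRP_trans \<alpha> \<theta>\<^sub>1 \<theta>\<^sub>2 x y * F y)"
    by (subst expectation_oCRP_sum) (simp_all add: marginal sum_distrib_right)
  also have "\<dots> = (\<Sum>x\<in>compositions n. measure M {\<omega> \<in> space M. C n \<omega> = x} *
      (\<Sum>y\<in>compositions (Suc n). oCRP_trans \<alpha> \<theta>\<^sub>1 \<theta>\<^sub>2 x y * F y))"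
    by (subst sum.swap) (simp add: sum_distrib_left mult.assoc)
  also have "\<dots> = (\<Sum>x\<in>compositions n. measure M {\<omega> \<in> space M. C n \<omega> = x} * step (seating_prob \<alpha> \<theta>\<^sub>1 \<theta>\<^sub>2) F x)"
    by (intro sum.cong refl) (simp add: step_seating_prob_eq_trans)
  finally show ?thesis using expectation_oCRP_sum[OF n] by simp
qed

text \<open>Conditioning on the last customer first, the averaging operator is peeled off at the end of the
  path; therefore the induction runs over all \<open>F\<close>.\<close>

lemma expectation_oCRP:
  "expectation (\<lambda>\<omega>. F (C (Suc n) \<omega>)) = (step (seating_prob \<alpha> \<theta>\<^sub>1 \<theta>\<^sub>2) ^^ n) F [1]"
proof (induction n arbitrary: F)
  case 0
  have "AE \<omega> in M. C 1 \<omega> = [1]" using oCRP unfolding is_oCRP_def by blast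
  moreover have "C 1 \<in> M \<rightarrow>\<^sub>M count_space UNIV" using oCRP unfolding is_oCRP_def by simp
  then have "(\<lambda>\<omega>. F (C 1 \<omega>)) \<in> borel_measurable M"
    by (rule measurable_compose) simp
  ultimately have "expectation (\<lambda>\<omega>. F (C 1 \<omega>)) = expectation (\<lambda>\<omega>. F [1])"
    by (intro integral_cong_AE) auto
  then show ?case by (simp add: prob_space)
next
  case (Suc n)
  then show ?case
    unfolding funpow_Suc_right comp_apply by (subst expectation_oCRP_step) simp_all
qed

end

section \<open>Seating new tables at the end\<close>

text \<open>The Chinese restaurant process whose tables are listed in order of appearance.\<close>

fun crp_prob :: "real \<Rightarrow> real \<Rightarrow> nat list \<Rightarrow> seating \<Rightarrow> real" where
  "crp_prob \<alpha> \<theta> c (Join i) = (real (c ! i) - \<alpha>) / (real (sum_list c) + \<theta>)"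
| "crp_prob \<alpha> \<theta> c (New j) =
     (if j = length c then \<theta> + real (length c) * \<alpha> else 0) / (real (sum_list c) + \<theta>)"

lemma step_crp_prob:
  "step (crp_prob \<alpha> \<theta>) F c
    = (\<Sum>i<length c. (real (c ! i) - \<alpha>) / (real (sum_list c) + \<theta>) * F (c[i := Suc (c ! i)]))
      + (\<theta> + real (length c) * \<alpha>) / (real (sum_list c) + \<theta>) * F (c @ [1])"
  by (subst step_append) simp_all

definition symmetric :: "(nat list \<Rightarrow> real) \<Rightarrow> bool" where
  "symmetric F \<longleftrightarrow> (\<forall>c c'. mset c = mset c' \<longrightarrow> F c = F c')"

lemma symmetricD: "symmetric F \<Longrightarrow> mset c = mset c' \<Longrightarrow> F c = F c'"
  unfolding symmetric_def by blast

text \<open>A symmetric function does not see where a new table is inserted, and with \<open>k\<close> tables the weights of all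
  places for a new table add up to \<open>\<theta>\<^sub>1 + \<theta>\<^sub>2 + (k - 1) \<alpha> = (\<theta>\<^sub>1 + \<theta>\<^sub>2 - \<alpha>) + k \<alpha>\<close>.\<close>

lemma step_seating_prob_symmetric:
  assumes F: "symmetric F" and c: "c \<noteq> []"
  shows "step (seating_prob \<alpha> \<theta>\<^sub>1 \<theta>\<^sub>2) F c = step (crp_prob \<alpha> (\<theta>\<^sub>1 + \<theta>\<^sub>2 - \<alpha>)) F c"
proof -
  obtain k where k: "length c = Suc k" using c by (cases c) auto
  define D where "D = real (sum_list c) + (\<theta>\<^sub>1 + \<theta>\<^sub>2 - \<alpha>)"
  have ins: "F (take j c @ [1] @ drop j c) = F (c @ [1])" for j
  proof (rule symmetricD[OF F])
    have "mset (take j c) + mset (drop j c) = mset c" by (metis append_take_drop_id mset_append)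
    then show "mset (take j c @ [1] @ drop j c) = mset (c @ [1])" by auto
  qed
  have "(\<Sum>j\<le>length c. (if j = 0 then \<theta>\<^sub>1 else if j = length c then \<theta>\<^sub>2 else \<alpha>))
        = \<theta>\<^sub>1 + (\<Sum>j\<le>k. if j = k then \<theta>\<^sub>2 else \<alpha>)"
    by (simp add: k sum.atMost_Suc_shift del: sum.atMost_Suc)
  also have "(\<Sum>j\<le>k. if j = k then \<theta>\<^sub>2 else \<alpha>) = (\<Sum>j<k. if j = k then \<theta>\<^sub>2 else \<alpha>) + \<theta>\<^sub>2"
    by (simp add: lessThan_Suc_atMost[symmetric])
  also have "(\<Sum>j<k. if j = k then \<theta>\<^sub>2 else \<alpha>) = (\<Sum>j<k. \<alpha>)" by (intro sum.cong) auto
  finally have new: "(\<Sum>j\<le>length c. (if j = 0 then \<theta>\<^sub>1 else if j = length c then \<theta>\<^sub>2 else \<alpha>))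
        = (\<theta>\<^sub>1 + \<theta>\<^sub>2 - \<alpha>) + real (length c) * \<alpha>" by (simp add: k algebra_simps)
  have "(\<Sum>j\<le>length c. seating_prob \<alpha> \<theta>\<^sub>1 \<theta>\<^sub>2 c (New j) * F (take j c @ [1] @ drop j c))
      = ((\<theta>\<^sub>1 + \<theta>\<^sub>2 - \<alpha>) + real (length c) * \<alpha>) / D * F (c @ [1])"
    unfolding ins seating_prob.simps D_def[symmetric] sum_distrib_right[symmetric]
      sum_divide_distrib[symmetric] new ..
  then show ?thesis unfolding step_split[of "seating_prob \<alpha> \<theta>\<^sub>1 \<theta>\<^sub>2"] step_crp_prob D_def by simp
qed

text \<open>The transition probabilities depend on a composition only through its multiset of parts; so symmetry
  survives a step, and the comparison of the two chains can be iterated.\<close>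

lemma symmetric_step_crp_prob:
  assumes F: "symmetric F"
  shows "symmetric (step (crp_prob \<alpha> \<theta>) F)"
  unfolding symmetric_def
proof (intro allI impI)
  fix c c' :: "nat list" assume eq: "mset c = mset c'"
  \<comment> \<open>a symmetric function factors through multisets\<close>
  obtain \<Phi> where \<Phi>: "\<And>c. F c = \<Phi> (mset c)"
    using that[of "\<lambda>A. F (SOME c. mset c = A)"] symmetricD[OF F]
    by (metis (mono_tags, lifting) someI)
  define H where "H A m = (real m - \<alpha>) / (real (\<Sum>\<^sub># A) + \<theta>) * \<Phi> (add_mset (Suc m) (A - {#m#}))" for A m
  have "step (crp_prob \<alpha> \<theta>) F c = (\<Sum>m\<in>#A. H A m)
      + (\<theta> + real (size A) * \<alpha>) / (real (\<Sum>\<^sub># A) + \<theta>) * \<Phi> (add_mset 1 A)"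
    if A: "A = mset c" for A c
  proof -
    have "(\<Sum>i<length c. (real (c ! i) - \<alpha>) / (real (sum_list c) + \<theta>) * F (c[i := Suc (c ! i)]))
      = (\<Sum>i<length c. H A (c ! i))"
      unfolding A H_def by (intro sum.cong refl) (simp add: \<Phi> mset_update sum_mset_sum_list)
    also have "\<dots> = sum_list (map (H A) c)"
      by (simp add: sum_list_sum_nth lessThan_atLeast0)
    also have "\<dots> = (\<Sum>m\<in>#A. H A m)"
      unfolding A by (simp add: sum_mset_sum_list[symmetric])
    finally show ?thesis unfolding step_crp_prob by (simp add: A \<Phi> sum_mset_sum_list)
  qed
  from this[OF refl] this[OF eq] show "step (crp_prob \<alpha> \<theta>) F c = step (crp_prob \<alpha> \<theta>) F c'" by simp
qed

lemma step_pow_seating_prob_symmetric: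
  assumes "symmetric F" "c \<noteq> []"
  shows "(step (seating_prob \<alpha> \<theta>\<^sub>1 \<theta>\<^sub>2) ^^ n) F c = (step (crp_prob \<alpha> (\<theta>\<^sub>1 + \<theta>\<^sub>2 - \<alpha>)) ^^ n) F c"
  using assms(1)
proof (induction n arbitrary: F)
  case (Suc n)
  have sym: "symmetric (step (crp_prob \<alpha> \<theta>) F)" for \<theta>
    by (rule symmetric_step_crp_prob[OF Suc.prems])
  have pow_cong: "(step p ^^ n) G c = (step p ^^ n) G' c"
    if "\<And>c. c \<noteq> [] \<Longrightarrow> G c = G' c" "c \<noteq> []" for p G G' n c
    using that
  proof (induction n arbitrary: c)
    case (Suc n)
    have "seat c s \<noteq> []" if "s \<in> seatings c" for s using Suc.prems(2) by (cases s) auto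
    then show ?case using Suc by (auto simp: step_def intro!: sum.cong)
  qed simp
  show ?case
    unfolding funpow_Suc_right comp_apply
    using pow_cong[OF step_seating_prob_symmetric[OF Suc.prems] assms(2)] Suc.IH[OF sym] by simp
qed simp

section \<open>Beta moments\<close>

lemma Beta_pos: "0 < a \<Longrightarrow> 0 < b \<Longrightarrow> 0 < Beta a (b::real)"
  unfolding Beta_def by (simp add: Gamma_real_pos)

lemma has_bochner_integral_Beta:
  fixes a b :: real
  assumes "0 < a" "0 < b"
  shows "has_bochner_integral lborel (\<lambda>x. indicator {0<..<1} x * (x powr (a - 1) * (1 - x) powr (b - 1))) (Beta a b)"
proof -
  have "((\<lambda>x. x powr (a - 1) * (1 - x) powr (b - 1)) has_integral Beta a b) {0<..<1}"
    using has_integral_Beta_real[OF assms] by (simp add: has_integral_Icc_iff_Ioo)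
  then have "((\<lambda>x. if x \<in> {0<..<1} then x powr (a - 1) * (1 - x) powr (b - 1) else 0) has_integral Beta a b) UNIV"
    by (simp only: has_integral_restrict_UNIV)
  moreover have "(\<lambda>x. if x \<in> {0<..<1} then x powr (a - 1) * (1 - x) powr (b - 1) else 0)
      = (\<lambda>x. indicator {0<..<1} x * (x powr (a - 1) * (1 - x) powr (b - 1)))"
    by (auto split: split_indicator)
  ultimately have "((\<lambda>x. indicator {0<..<1} x * (x powr (a - 1) * (1 - x) powr (b - 1))) has_integral Beta a b) UNIV"
    by simp
  then have "(\<integral>\<^sup>+x. ennreal (indicator {0<..<1} x * (x powr (a - 1) * (1 - x) powr (b - 1))) \<partial>lborel) = ennreal (Beta a b)"
    by (intro nn_integral_has_integral_lborel) auto
  then show ?thesis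
    using Beta_pos[OF assms] by (intro has_bochner_integral_nn_integral) auto
qed

context
  fixes a b :: real
  assumes ab: "0 < a" "0 < b"
begin

lemma beta_moment:
  "has_bochner_integral (beta_distribution a b) (\<lambda>x. x ^ m * (1 - x) ^ n) (Beta (a + real m) (b + real n) / Beta a b)"
proof -
  have "has_bochner_integral lborel
      (\<lambda>x. indicator {0<..<1} x * (x powr (a + real m - 1) * (1 - x) powr (b + real n - 1)) / Beta a b)
      (Beta (a + real m) (b + real n) / Beta a b)"
    using ab by (intro has_bochner_integral_divide_zero has_bochner_integral_Beta) auto
  moreover have "indicator {0<..<1} x * (x powr (a + real m - 1) * (1 - x) powr (b + real n - 1)) / Beta a b
      = (indicator {0<..<1} x * (x powr (a - 1) * (1 - x) powr (b - 1) / Beta a b)) *\<^sub>R (x ^ m * (1 - x) ^ n)" for x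
  proof (cases "x \<in> {0<..<1}")
    case True
    have "x powr (a + real m - 1) = x powr (a - 1) * x ^ m"
      "(1 - x) powr (b + real n - 1) = (1 - x) powr (b - 1) * (1 - x) ^ n"
      using True by (simp_all add: powr_realpow[symmetric] powr_add[symmetric] algebra_simps)
    then show ?thesis by simp
  qed simp
  ultimately show ?thesis
    unfolding beta_distribution_def using Beta_pos[OF ab]
    by (intro has_bochner_integral_density) auto
qed

lemma prob_space_beta_distribution: "prob_space (beta_distribution a b)"
proof
  have "(\<integral>\<^sup>+x. ennreal (indicator {0<..<1} x * (x powr (a - 1) * (1 - x) powr (b - 1) / Beta a b)) \<partial>lborel)
      = ennreal (Beta a b / Beta a b)"
    using has_bochner_integral_divide_zero[OF has_bochner_integral_Beta[OF ab], of "Beta a b"] Beta_pos[OF ab]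
    by (subst nn_integral_eq_integral) (auto simp: has_bochner_integral_iff)
  then show "emeasure (beta_distribution a b) (space (beta_distribution a b)) = 1"
    unfolding beta_distribution_def using Beta_pos[OF ab]
    by (subst emeasure_density) auto
qed

lemma AE_beta_distribution: "AE x in beta_distribution a b. 0 < x \<and> x < 1"
  unfolding beta_distribution_def
  by (subst AE_density) (auto split: split_indicator)

end

lemma sets_beta_distribution [measurable_cong]: "sets (beta_distribution a b) = sets borel"
  unfolding beta_distribution_def by simp

section \<open>Seating probabilities given the sticks\<close>

text \<open>Given the sticks \<open>w\<close>, this is the probability of one particular sequence of seatings that produces the
  composition in order of appearance; all such sequences have the same probability. Table \<open>i\<close> contributes
  one factor \<open>w i\<close> for each customer except the one who opens it, and one factor \<open>1 - w i\<close> for each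
  customer at a later table.\<close>

primrec stick_weight :: "(nat \<Rightarrow> real) \<Rightarrow> nat list \<Rightarrow> real" where
  "stick_weight w [] = 1"
| "stick_weight w (m # c) = w 0 ^ (m - 1) * (1 - w 0) ^ sum_list c * stick_weight (\<lambda>i. w (Suc i)) c"

text \<open>The mean of \<open>stick_weight\<close> when the sticks are independent with the beta laws of \<open>PD\<close>: dropping the
  first table turns \<open>\<theta>\<close> into \<open>\<theta> + \<alpha>\<close>.\<close>

primrec beta_weight :: "real \<Rightarrow> real \<Rightarrow> nat list \<Rightarrow> real" where
  "beta_weight \<alpha> \<theta> [] = 1"
| "beta_weight \<alpha> \<theta> (m # c) = Beta (real m - \<alpha>) (\<theta> + \<alpha> + real (sum_list c)) / Beta (1 - \<alpha>) (\<theta> + \<alpha>)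
     * beta_weight \<alpha> (\<theta> + \<alpha>) c"

text \<open>An open table \<open>i\<close> attracts every customer with the fixed probability \<open>stick_breaking w i\<close>; what
  the open tables leave over is the probability of a new table.\<close>

fun stick_prob :: "(nat \<Rightarrow> real) \<Rightarrow> nat list \<Rightarrow> seating \<Rightarrow> real" where
  "stick_prob w c (Join i) = stick_breaking w i"
| "stick_prob w c (New j) = (if j = length c then \<Prod>j<length c. 1 - w j else 0)"

lemma step_stick_prob:
  "step (stick_prob w) F c = (\<Sum>i<length c. stick_breaking w i * F (c[i := Suc (c ! i)]))
     + (\<Prod>j<length c. 1 - w j) * F (c @ [1])"
  by (subst step_append) simp_all

lemma stick_breaking_Suc: "stick_breaking w (Suc i) = (1 - w 0) * stick_breaking (\<lambda>i. w (Suc i)) i"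
  unfolding stick_breaking_def by (simp add: prod.lessThan_Suc_shift del: prod.lessThan_Suc)

lemma stick_weight_Join:
  assumes "i < length c" "\<forall>m\<in>set c. 1 \<le> m"
  shows "stick_weight w (c[i := Suc (c ! i)]) = stick_weight w c * stick_breaking w i"
  using assms
proof (induction c arbitrary: i w)
  case (Cons m c)
  show ?case
  proof (cases i)
    case 0
    obtain m' where "m = Suc m'" using Cons.prems(2) by (cases m) auto
    then show ?thesis using 0 by (simp add: stick_breaking_def)
  next
    case (Suc j)
    then have j: "j < length c" using Cons.prems by simp
    then show ?thesis
      using Cons Suc by (simp add: stick_breaking_Suc sum_list_Suc_update[OF j])
  qed
qed simp

lemma stick_weight_New: "stick_weight w (c @ [1]) = stick_weight w c * (\<Prod>j<length c. 1 - w j)"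
  by (induction c arbitrary: w) (simp_all add: prod.lessThan_Suc_shift del: prod.lessThan_Suc)

lemma Beta_plus1_left': "0 < a \<Longrightarrow> 0 < b \<Longrightarrow> Beta (a + 1) b = Beta a b * a / (a + (b::real))"
  using Beta_plus1_left[of a b] by (auto simp: field_simps nonpos_Ints_def)

lemma Beta_plus1_right': "0 < a \<Longrightarrow> 0 < b \<Longrightarrow> Beta a (b + 1) = Beta a b * b / (a + (b::real))"
  using Beta_plus1_left'[of b a] by (simp add: Beta_commute add.commute)

context
  fixes \<alpha> :: real
  assumes \<alpha>: "0 < \<alpha>" "\<alpha> < 1"
begin

text \<open>Joining table \<open>i\<close> raises one beta exponent at table \<open>i\<close> and one at each earlier table. In the resulting
  product of ratios each numerator is the next denominator, and only the seating probability of the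
  Chinese restaurant process is left.\<close>

lemma beta_weight_Join:
  assumes "i < length c" "\<forall>m\<in>set c. 1 \<le> m" "- \<alpha> < \<theta>"
  shows "beta_weight \<alpha> \<theta> (c[i := Suc (c ! i)])
    = beta_weight \<alpha> \<theta> c * ((real (c ! i) - \<alpha>) / (real (sum_list c) + \<theta>))"
  using assms
proof (induction c arbitrary: i \<theta>)
  case (Cons m c)
  define b where "b = \<theta> + \<alpha> + real (sum_list c)"
  have "1 \<le> real m" using Cons.prems(2) by simp
  then have m: "0 < real m - \<alpha>" using \<alpha> by simp
  have b: "0 < b" using Cons.prems(3) unfolding b_def by simp
  show ?case
  proof (cases i)
    case 0
    have "Beta (real m + 1 - \<alpha>) b = Beta (real m - \<alpha>) b * ((real m - \<alpha>) / (real m + real (sum_list c) + \<theta>))"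
      using Beta_plus1_left'[OF m b] by (simp add: b_def algebra_simps)
    then show ?thesis using 0 by (simp add: b_def algebra_simps)
  next
    case (Suc j)
    then have j: "j < length c" using Cons.prems by simp
    have IH: "beta_weight \<alpha> (\<theta> + \<alpha>) (c[j := Suc (c ! j)])
        = beta_weight \<alpha> (\<theta> + \<alpha>) c * ((real (c ! j) - \<alpha>) / b)"
      using Cons.IH[OF j, of "\<theta> + \<alpha>"] Cons.prems \<alpha> by (simp add: b_def algebra_simps)
    have "Beta (real m - \<alpha>) (b + 1) = Beta (real m - \<alpha>) b * b / (real m + real (sum_list c) + \<theta>)"
      using Beta_plus1_right'[OF m b] by (simp add: b_def algebra_simps)
    moreover have "\<theta> + \<alpha> + real (sum_list (c[j := Suc (c ! j)])) = b + 1"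
      by (simp add: sum_list_Suc_update[OF j] b_def)
    ultimately show ?thesis using Suc IH b by (simp add: b_def[symmetric] mult_ac)
  qed
qed simp

text \<open>The same telescoping as for joining a table. For the empty list the seating probability is \<open>\<theta> / \<theta>\<close>,
  which equals \<open>1\<close> only if \<open>\<theta> \<noteq> 0\<close>.\<close>

lemma beta_weight_New:
  assumes "- \<alpha> < \<theta>" "c \<noteq> [] \<or> \<theta> \<noteq> 0" "\<forall>m\<in>set c. 1 \<le> m"
  shows "beta_weight \<alpha> \<theta> (c @ [1])
    = beta_weight \<alpha> \<theta> c * ((\<theta> + real (length c) * \<alpha>) / (real (sum_list c) + \<theta>))"
  using assms
proof (induction c arbitrary: \<theta>)
  case Nil
  then have "0 < Beta (1 - \<alpha>) (\<theta> + \<alpha>)" using \<alpha> by (intro Beta_pos) auto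
  then show ?case using Nil by simp
next
  case (Cons m c)
  define b where "b = \<theta> + \<alpha> + real (sum_list c)"
  have "1 \<le> real m" using Cons.prems(3) by simp
  then have m: "0 < real m - \<alpha>" using \<alpha> by simp
  have b: "0 < b" using Cons.prems(1) unfolding b_def by simp
  have IH: "beta_weight \<alpha> (\<theta> + \<alpha>) (c @ [1])
      = beta_weight \<alpha> (\<theta> + \<alpha>) c * ((\<theta> + real (Suc (length c)) * \<alpha>) / b)"
    using Cons.IH[of "\<theta> + \<alpha>"] Cons.prems \<alpha> by (simp add: b_def algebra_simps)
  have "Beta (real m - \<alpha>) (b + 1) = Beta (real m - \<alpha>) b * b / (real m + real (sum_list c) + \<theta>)"
    using Beta_plus1_right'[OF m b] by (simp add: b_def algebra_simps)
  moreover have S: "\<theta> + \<alpha> + real (sum_list (c @ [1])) = b + 1" by (simp add: b_def)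
  have "beta_weight \<alpha> \<theta> ((m # c) @ [1])
      = Beta (real m - \<alpha>) (b + 1) / Beta (1 - \<alpha>) (\<theta> + \<alpha>) * beta_weight \<alpha> (\<theta> + \<alpha>) (c @ [1])"
    by (simp only: append_Cons beta_weight.simps S)
  ultimately show ?case using IH b by (simp add: b_def[symmetric] mult_ac)
qed

end

lemma stick_weight_prod:
  "stick_weight w c = (\<Prod>i<length c. w i ^ (c ! i - 1) * (1 - w i) ^ sum_list (drop (Suc i) c))"
  by (induction c arbitrary: w) (simp_all add: prod.lessThan_Suc_shift del: prod.lessThan_Suc)

lemma beta_weight_prod:
  "beta_weight \<alpha> \<theta> c = (\<Prod>i<length c. Beta (real (c ! i) - \<alpha>) (\<theta> + real (Suc i) * \<alpha> + real (sum_list (drop (Suc i) c)))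
     / Beta (1 - \<alpha>) (\<theta> + real (Suc i) * \<alpha>))"
  by (induction c arbitrary: \<theta>)
    (simp_all add: prod.lessThan_Suc_shift algebra_simps del: prod.lessThan_Suc)

section \<open>Mixing over the sticks\<close>

definition stick_law :: "real \<Rightarrow> real \<Rightarrow> (nat \<Rightarrow> real) measure" where
  "stick_law \<alpha> \<theta> = (\<Pi>\<^sub>M i\<in>UNIV. beta_distribution (1 - \<alpha>) (\<theta> + real (Suc i) * \<alpha>))"

context
  fixes \<alpha> \<theta> :: real
  assumes \<alpha>: "0 < \<alpha>" "\<alpha> < 1" and \<theta>: "- \<alpha> < \<theta>"
begin

lemma stick_param_pos: "0 < 1 - \<alpha>" "0 < \<theta> + real (Suc i) * \<alpha>"
proof -
  have "0 < \<theta> + \<alpha>" "0 \<le> real i * \<alpha>" using \<alpha> \<theta> by auto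
  then show "0 < \<theta> + real (Suc i) * \<alpha>" by (simp add: algebra_simps)
qed (use \<alpha> in simp)

lemma product_prob_space_sticks:
  "product_prob_space (\<lambda>i. beta_distribution (1 - \<alpha>) (\<theta> + real (Suc i) * \<alpha>))"
  by (intro product_prob_spaceI prob_space_beta_distribution stick_param_pos)

lemma prob_space_stick_law: "prob_space (stick_law \<alpha> \<theta>)"
  unfolding stick_law_def by (intro prob_space_PiM prob_space_beta_distribution stick_param_pos)

lemma measurable_stick [measurable]: "(\<lambda>w. w i) \<in> borel_measurable (stick_law \<alpha> \<theta>)"
proof -
  have "(\<lambda>w. w i) \<in> stick_law \<alpha> \<theta> \<rightarrow>\<^sub>M beta_distribution (1 - \<alpha>) (\<theta> + real (Suc i) * \<alpha>)"
    unfolding stick_law_def by (rule measurable_component_singleton) simp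
  then show ?thesis by (simp cong: measurable_cong_sets add: sets_beta_distribution)
qed

lemma AE_stick_law: "AE w in stick_law \<alpha> \<theta>. \<forall>i. 0 < w i \<and> w i < 1"
  unfolding AE_all_countable stick_law_def
  by (intro allI AE_PiM_component[where P="\<lambda>x. 0 < x \<and> x < 1"] prob_space_beta_distribution
      AE_beta_distribution stick_param_pos) simp

lemma stick_law_prod:
  assumes "\<And>i. has_bochner_integral (beta_distribution (1 - \<alpha>) (\<theta> + real (Suc i) * \<alpha>)) (f i) (r i)"
  shows "has_bochner_integral (stick_law \<alpha> \<theta>) (\<lambda>w. \<Prod>i<k. f i (w i)) (\<Prod>i<k. r i :: real)"
proof -
  let ?B = "\<lambda>i. beta_distribution (1 - \<alpha>) (\<theta> + real (Suc i) * \<alpha>)"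
  interpret product_prob_space ?B UNIV by (rule product_prob_space_sticks)
  have int: "integrable (?B i) (f i)" and val: "integral\<^sup>L (?B i) (f i) = r i" for i
    using assms[of i] by (auto simp: has_bochner_integral_iff)
  have distr: "distr (stick_law \<alpha> \<theta>) (PiM {..<k} ?B) (\<lambda>w. restrict w {..<k}) = PiM {..<k} ?B"
    unfolding stick_law_def by (rule distr_PiM_restrict_finite) auto
  have m: "(\<lambda>w. restrict w {..<k}) \<in> stick_law \<alpha> \<theta> \<rightarrow>\<^sub>M PiM {..<k} ?B"
    unfolding stick_law_def by (rule measurable_restrict_subset) simp
  have int': "integrable (PiM {..<k} ?B) (\<lambda>x. \<Prod>i<k. f i (x i))"
    using product_integrable_prod[of "{..<k}" f] int by (simp del: of_nat_Suc)
  have val': "(\<integral>x. (\<Prod>i<k. f i (x i)) \<partial>PiM {..<k} ?B) = (\<Prod>i<k. r i)"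
    using product_integral_prod[of "{..<k}" f] int val by (simp del: of_nat_Suc)
  have bm: "(\<lambda>x. \<Prod>i<k. f i (x i)) \<in> borel_measurable (PiM {..<k} ?B)" using int' by auto
  have eq: "(\<Prod>i<k. f i (restrict w {..<k} i)) = (\<Prod>i<k. f i (w i))" for w by simp
  have "integrable (stick_law \<alpha> \<theta>) (\<lambda>w. \<Prod>i<k. f i (w i))"
    using int' integrable_distr_eq[OF m bm] unfolding distr eq by simp
  moreover have "(\<integral>w. (\<Prod>i<k. f i (w i)) \<partial>stick_law \<alpha> \<theta>) = (\<Prod>i<k. r i)"
    using val' integral_distr[OF m bm] unfolding distr eq by simp
  ultimately show ?thesis by (simp add: has_bochner_integral_iff)
qed

lemma expectation_stick_weight:
  assumes "\<forall>m\<in>set c. 1 \<le> m"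
  shows "has_bochner_integral (stick_law \<alpha> \<theta>) (\<lambda>w. stick_weight w c) (beta_weight \<alpha> \<theta> c)"
proof -
  let ?m = "\<lambda>i. c ! i - 1" and ?n = "\<lambda>i. sum_list (drop (Suc i) c)"
  have "has_bochner_integral (stick_law \<alpha> \<theta>) (\<lambda>w. \<Prod>i<length c. w i ^ ?m i * (1 - w i) ^ ?n i)
     (\<Prod>i<length c. Beta (1 - \<alpha> + real (?m i)) (\<theta> + real (Suc i) * \<alpha> + real (?n i))
       / Beta (1 - \<alpha>) (\<theta> + real (Suc i) * \<alpha>))"
    by (intro stick_law_prod beta_moment stick_param_pos)
  moreover have m: "1 - \<alpha> + real (?m i) = real (c ! i) - \<alpha>" if "i < length c" for i
    using assms nth_mem[OF that] by (simp add: of_nat_diff)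
  have "(\<Prod>i<length c. Beta (1 - \<alpha> + real (?m i)) (\<theta> + real (Suc i) * \<alpha> + real (?n i))
       / Beta (1 - \<alpha>) (\<theta> + real (Suc i) * \<alpha>)) = beta_weight \<alpha> \<theta> c"
    unfolding beta_weight_prod by (intro prod.cong refl) (simp only: m lessThan_iff)
  ultimately show ?thesis unfolding stick_weight_prod by simp
qed

text \<open>Once \<open>c\<close> has been observed, the sticks are distributed with density proportional to \<open>stick_weight w c\<close>.
  The weight therefore belongs into the induction: it turns one step of the chain with given sticks into
  a sum of weights of the successors of \<open>c\<close>, which integrate to the weights of the Chinese restaurant
  process.\<close>

lemma stick_mixture_weighted:
  assumes "c \<in> compositions m" "c \<noteq> []"
  shows "has_bochner_integral (stick_law \<alpha> \<theta>)
     (\<lambda>w. stick_weight w c * (step (stick_prob w) ^^ n) F c)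
     (beta_weight \<alpha> \<theta> c * (step (crp_prob \<alpha> \<theta>) ^^ n) F c)"
  using assms
proof (induction n arbitrary: c m)
  case 0
  then show ?case
    using expectation_stick_weight[of c] by (auto simp: compositions_def intro!: has_bochner_integral_mult_left)
next
  case (Suc n)
  have pos: "\<forall>m\<in>set c. 1 \<le> m" using Suc.prems unfolding compositions_def by blast
  have J: "c[i := Suc (c ! i)] \<in> compositions (Suc m)" if "i < length c" for i
    using seat_compositions[OF Suc.prems(1), of "Join i"] that by (simp add: seatings_def)
  have N: "c @ [1] \<in> compositions (Suc m)"
    using seat_compositions[OF Suc.prems(1), of "New (length c)"] by (simp add: seatings_def)
  let ?S = "\<lambda>w. (step (stick_prob w) ^^ n) F" and ?C = "(step (crp_prob \<alpha> \<theta>) ^^ n) F"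
  have "has_bochner_integral (stick_law \<alpha> \<theta>)
     (\<lambda>w. (\<Sum>i<length c. stick_weight w (c[i := Suc (c ! i)]) * ?S w (c[i := Suc (c ! i)]))
        + stick_weight w (c @ [1]) * ?S w (c @ [1]))
     ((\<Sum>i<length c. beta_weight \<alpha> \<theta> (c[i := Suc (c ! i)]) * ?C (c[i := Suc (c ! i)]))
        + beta_weight \<alpha> \<theta> (c @ [1]) * ?C (c @ [1]))"
    using Suc.prems(2)
    by (intro has_bochner_integral_add has_bochner_integral_sum Suc.IH[OF N] Suc.IH[OF J]) auto
  moreover have "(\<Sum>i<length c. stick_weight w (c[i := Suc (c ! i)]) * ?S w (c[i := Suc (c ! i)]))
        + stick_weight w (c @ [1]) * ?S w (c @ [1]) = stick_weight w c * (step (stick_prob w) ^^ Suc n) F c" for w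
    unfolding funpow.simps comp_apply step_stick_prob stick_weight_New
    by (simp add: stick_weight_Join[OF _ pos] sum_distrib_left distrib_left mult_ac)
  moreover have "(\<Sum>i<length c. beta_weight \<alpha> \<theta> (c[i := Suc (c ! i)]) * ?C (c[i := Suc (c ! i)]))
        + beta_weight \<alpha> \<theta> (c @ [1]) * ?C (c @ [1]) = beta_weight \<alpha> \<theta> c * (step (crp_prob \<alpha> \<theta>) ^^ Suc n) F c"
    unfolding funpow.simps comp_apply step_crp_prob beta_weight_New[OF \<alpha> \<theta> disjI1[OF Suc.prems(2)] pos]
    by (simp add: beta_weight_Join[OF \<alpha> _ pos \<theta>] sum_distrib_left distrib_left mult_ac)
  ultimately show ?case by simp
qed

text \<open>The composition with a single customer has weight \<open>1\<close>, so the weights disappear: averaging the chains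
  with given sticks over the law of the sticks gives the Chinese restaurant process.\<close>

lemma stick_mixture:
  "has_bochner_integral (stick_law \<alpha> \<theta>) (\<lambda>w. (step (stick_prob w) ^^ n) F [1]) ((step (crp_prob \<alpha> \<theta>) ^^ n) F [1])"
proof -
  have "0 < Beta (1 - \<alpha>) (\<theta> + \<alpha>)" using \<alpha> \<theta> by (intro Beta_pos) auto
  then show ?thesis
    using stick_mixture_weighted[of "[1]" 1 n F] by (simp add: compositions_def)
qed

section \<open>The sticks exhaust the unit interval\<close>

text \<open>The \<open>i\<close>-th factor is \<open>1 - (1 - \<alpha>) / (1 + \<theta> + i \<alpha>)\<close>, and the subtracted terms have a divergent sum by
  comparison with the harmonic series.\<close>

lemma prod_stick_param_tendsto_0:
  "(\<lambda>k. \<Prod>i<k. (\<theta> + real (Suc i) * \<alpha>) / (1 - \<alpha> + (\<theta> + real (Suc i) * \<alpha>))) \<longlonglongrightarrow> 0"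
proof -
  define q where "q i = (\<theta> + real (Suc i) * \<alpha>) / (1 - \<alpha> + (\<theta> + real (Suc i) * \<alpha>))" for i
  define d where "d = (1 - \<alpha>) / (1 + \<bar>\<theta>\<bar>)"
  have q: "0 \<le> q i" "q i \<le> exp (- (d * inverse (real (Suc i))))" for i
  proof -
    have p: "0 < \<theta> + real (Suc i) * \<alpha>" by (rule stick_param_pos)
    show "0 \<le> q i" unfolding q_def using p \<alpha> by (intro divide_nonneg_nonneg) auto
    have D': "1 - \<alpha> + (\<theta> + n * \<alpha>) \<le> (1 + \<bar>\<theta>\<bar>) * n" if "1 \<le> n" for n :: real
    proof -
      have "(n - 1) * \<alpha> \<le> (n - 1) * 1" using \<alpha> that by (intro mult_left_mono) auto
      moreover have "\<bar>\<theta>\<bar> * 1 \<le> \<bar>\<theta>\<bar> * n" using that by (intro mult_left_mono) auto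
      ultimately show ?thesis unfolding distrib_right left_diff_distrib by linarith
    qed
    have D: "1 - \<alpha> + (\<theta> + real (Suc i) * \<alpha>) \<le> (1 + \<bar>\<theta>\<bar>) * real (Suc i)"
      by (rule D') simp
    have pD: "0 < 1 - \<alpha> + (\<theta> + real (Suc i) * \<alpha>)" using p \<alpha> by simp
    have "d * inverse (real (Suc i)) = (1 - \<alpha>) / ((1 + \<bar>\<theta>\<bar>) * real (Suc i))"
      by (simp add: d_def divide_inverse)
    also have "\<dots> \<le> (1 - \<alpha>) / (1 - \<alpha> + (\<theta> + real (Suc i) * \<alpha>))"
      using D pD \<alpha> by (intro divide_left_mono mult_pos_pos) (auto intro!: mult_pos_pos add_pos_nonneg)
    also have "\<dots> = 1 - q i" using pD unfolding q_def by (simp add: field_simps)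
    finally have "1 + - (d * inverse (real (Suc i))) \<ge> q i" by simp
    then show "q i \<le> exp (- (d * inverse (real (Suc i))))"
      using exp_ge_add_one_self[of "- (d * inverse (real (Suc i)))"] by linarith
  qed
  have upper: "(\<Prod>i<k. q i) \<le> exp (- (d * harm k))" for k
  proof -
    have "(\<Prod>i<k. q i) \<le> (\<Prod>i<k. exp (- (d * inverse (real (Suc i)))))"
      using q by (intro prod_mono) auto
    also have "\<dots> = exp (\<Sum>i<k. - (d * inverse (real (Suc i))))" by (simp add: exp_sum)
    also have "(\<Sum>i<k. - (d * inverse (real (Suc i)))) = - (d * harm k)"
      unfolding harm_def by (simp add: sum_negf sum_distrib_left sum.atLeast1_atMost_eq)
    finally show ?thesis .
  qed
  have lim: "(\<lambda>k. exp (- (d * harm k))) \<longlonglongrightarrow> 0"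
  proof -
    have "0 < d" using \<alpha> unfolding d_def by simp
    then have "filterlim (\<lambda>k. d * harm k) at_top sequentially"
      by (intro filterlim_tendsto_pos_mult_at_top[OF tendsto_const _ harm_at_top])
    then show ?thesis
      by (intro filterlim_compose[OF exp_at_bot] filterlim_uminus_at_bot_at_top[THEN filterlim_compose])
  qed
  have lower: "0 \<le> (\<Prod>i<k. q i)" for k using q(1) by (intro prod_nonneg) simp
  show ?thesis
    unfolding q_def[symmetric]
    by (rule tendsto_sandwich[OF always_eventually[OF allI] always_eventually[OF allI] tendsto_const lim])
      (rule lower, rule upper)
qed

text \<open>The remainders decrease, so they converge; their means tend to \<open>0\<close>, so the limit has mean \<open>0\<close>.\<close>

lemma AE_stick_remainder_tendsto_0:
  "AE w in stick_law \<alpha> \<theta>. (\<lambda>k. \<Prod>j<k. 1 - w j) \<longlonglongrightarrow> 0"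
proof -
  let ?R = "\<lambda>k w. \<Prod>j<k. 1 - w j :: real" and ?P = "stick_law \<alpha> \<theta>"
  interpret prob_space ?P by (rule prob_space_stick_law)
  define L where "L w = lim (\<lambda>k. ?R k w)" for w :: "nat \<Rightarrow> real"
  have conv: "(\<lambda>k. ?R k w) \<longlonglongrightarrow> L w \<and> 0 \<le> L w \<and> (\<forall>k. \<bar>?R k w\<bar> \<le> 1)"
    if w: "\<forall>i. 0 < w i \<and> w i < 1" for w
  proof -
    have nn: "0 \<le> ?R k w" for k using w by (intro prod_nonneg) (auto simp: less_imp_le)
    have le1: "?R k w \<le> 1" for k using w by (intro prod_le_1) (auto simp: less_imp_le)
    have "decseq (\<lambda>k. ?R k w)"
      using w nn by (intro decseq_SucI) (auto simp: less_imp_le intro!: mult_left_le)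
    then have "convergent (\<lambda>k. ?R k w)"
      using nn le1 by (intro Bseq_monoseq_convergent BseqI'[of _ 1] decseq_imp_monoseq) auto
    then have "(\<lambda>k. ?R k w) \<longlonglongrightarrow> L w" unfolding L_def by (simp add: convergent_LIMSEQ_iff)
    then show ?thesis using nn le1 LIMSEQ_le_const[of "\<lambda>k. ?R k w" "L w" 0] by auto
  qed
  have meas: "?R k \<in> borel_measurable ?P" for k by measurable
  have AE: "AE w in ?P. (\<lambda>k. ?R k w) \<longlonglongrightarrow> L w \<and> 0 \<le> L w \<and> (\<forall>k. \<bar>?R k w\<bar> \<le> 1)"
    using AE_stick_law by eventually_elim (rule conv)
  have Lm: "L \<in> borel_measurable ?P" unfolding L_def using meas by (rule borel_measurable_lim_metric)
  have lim: "AE w in ?P. (\<lambda>k. ?R k w) \<longlonglongrightarrow> L w" using AE by eventually_elim blast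
  have bound: "AE w in ?P. norm (?R k w) \<le> 1" for k using AE by eventually_elim simp
  have one: "integrable ?P (\<lambda>_. 1 :: real)" by simp
  note L_int = integrable_dominated_convergence[OF Lm meas one lim bound]
  have "(\<lambda>k. integral\<^sup>L ?P (?R k)) \<longlonglongrightarrow> integral\<^sup>L ?P L"
    by (rule integral_dominated_convergence[OF Lm meas one lim bound])
  moreover have "integral\<^sup>L ?P (?R k) = (\<Prod>i<k. (\<theta> + real (Suc i) * \<alpha>) / (1 - \<alpha> + (\<theta> + real (Suc i) * \<alpha>)))" for k
  proof -
    have "has_bochner_integral (beta_distribution (1 - \<alpha>) (\<theta> + real (Suc i) * \<alpha>)) (\<lambda>x. 1 - x)
        ((\<theta> + real (Suc i) * \<alpha>) / (1 - \<alpha> + (\<theta> + real (Suc i) * \<alpha>)))" for i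
      using beta_moment[OF stick_param_pos(1) stick_param_pos(2)[of i], of 0 1]
        Beta_plus1_right'[OF stick_param_pos(1) stick_param_pos(2)[of i]]
        Beta_pos[OF stick_param_pos(1) stick_param_pos(2)[of i]] by simp
    then show ?thesis
      using stick_law_prod[of "\<lambda>_ x. 1 - x"] by (simp add: has_bochner_integral_iff)
  qed
  ultimately have "integral\<^sup>L ?P L = 0"
    using prod_stick_param_tendsto_0 by (auto intro: LIMSEQ_unique)
  moreover have "AE w in ?P. 0 \<le> L w" using AE by eventually_elim simp
  ultimately have "AE w in ?P. L w = 0"
    using L_int integral_nonneg_eq_0_iff_AE by blast
  with AE show ?thesis by eventually_elim auto
qed

end

section \<open>Law of large numbers for given sticks\<close>

definition remainder :: "(nat \<Rightarrow> real) \<Rightarrow> nat \<Rightarrow> real" where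
  "remainder w k = (\<Prod>j<k. 1 - w j)"

definition table_size :: "nat list \<Rightarrow> nat \<Rightarrow> real" where
  "table_size c i = (if i < length c then real (c ! i) else 0)"

lemma table_fraction_eq: "table_fraction c i = table_size c i / real (sum_list c)"
  unfolding table_fraction_def table_size_def by simp

lemma sum_table_fraction_le_1:
  assumes "finite J"
  shows "sum (table_fraction c) J \<le> 1"
proof -
  have "sum (table_fraction c) J \<le> sum (table_fraction c) (J \<union> {..<length c})"
    using assms by (intro sum_mono2) (auto simp: table_fraction_def)
  also have "\<dots> = sum (table_fraction c) {..<length c}"
    using assms by (intro sum.mono_neutral_right) (auto simp: table_fraction_def)
  also have "\<dots> = (\<Sum>i<length c. real (c ! i)) / real (sum_list c)"
    by (simp add: table_fraction_def sum_divide_distrib)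
  also have "(\<Sum>i<length c. real (c ! i)) = real (sum_list c)"
    by (simp add: sum_list_sum_nth lessThan_atLeast0)
  finally show ?thesis by (simp split: if_splits)
qed

context
  fixes w :: "nat \<Rightarrow> real"
  assumes w: "\<forall>i. 0 < w i \<and> w i < 1"
begin

lemma remainder_pos: "0 < remainder w k"
  unfolding remainder_def using w by (intro prod_pos) simp

lemma stick_breaking_remainder: "stick_breaking w i = w i * remainder w i"
  unfolding stick_breaking_def remainder_def ..

lemma remainder_Suc: "remainder w (Suc k) = remainder w k - stick_breaking w k"
  unfolding stick_breaking_remainder by (simp add: remainder_def algebra_simps)

lemma stick_breaking_pos: "0 < stick_breaking w i"
  unfolding stick_breaking_remainder using w remainder_pos by simp

lemma sum_stick_breaking: "(\<Sum>i<k. stick_breaking w i) = 1 - remainder w k"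
  by (induction k) (simp_all add: remainder_Suc, simp add: remainder_def)

lemma decseq_remainder: "decseq (remainder w)"
  by (rule decseq_SucI) (simp add: remainder_Suc less_imp_le[OF stick_breaking_pos])

lemma remainder_le_1: "remainder w k \<le> 1"
  using decseqD[OF decseq_remainder, of 0 k] by (simp add: remainder_def)

lemma stick_breaking_le_remainder: "k \<le> i \<Longrightarrow> stick_breaking w i \<le> remainder w k"
  using decseqD[OF decseq_remainder, of k i] remainder_pos[of "Suc i"] remainder_Suc[of i] by simp

lemma stick_breaking_le_1: "stick_breaking w i \<le> 1"
  using stick_breaking_le_remainder[of 0 i] by (simp add: remainder_def)

lemma stick_prob_nonneg: "0 \<le> stick_prob w c s"
  using less_imp_le[OF stick_breaking_pos] less_imp_le[OF remainder_pos, unfolded remainder_def]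
  by (cases s) auto

lemma step_stick_prob_remainder:
  "step (stick_prob w) F c = (\<Sum>i<length c. stick_breaking w i * F (c[i := Suc (c ! i)]))
     + remainder w (length c) * F (c @ [1])"
  unfolding step_stick_prob remainder_def ..

lemma sum_stick_prob: "(\<Sum>s\<in>seatings c. stick_prob w c s) = 1"
  using step_stick_prob_remainder[of "\<lambda>_. 1" c] sum_stick_breaking by (simp add: step_def)

lemma singleton_composition: "[1] \<in> compositions 1"
  by (simp add: compositions_def)

lemma step_pow_stick_mono:
  assumes "\<And>c. c \<in> compositions (Suc n) \<Longrightarrow> F c \<le> G c"
  shows "(step (stick_prob w) ^^ n) F [1] \<le> (step (stick_prob w) ^^ n) G [1]"
  using step_pow_mono[of "stick_prob w" "[1]" 1 n F G] stick_prob_nonneg singleton_composition assms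
  by simp

lemma step_pow_stick_const: "(step (stick_prob w) ^^ n) (\<lambda>_. a) c = a"
  by (rule step_pow_const) (rule sum_stick_prob)

definition unopened :: "nat \<Rightarrow> nat list \<Rightarrow> real" where
  "unopened i c = (if length c \<le> i then 1 else 0)"

lemma step_missing_tables:
  "step (stick_prob w) (\<lambda>c. real (Suc i - length c)) c
    \<le> real (Suc i - length c) - remainder w i * unopened i c"
proof -
  have "step (stick_prob w) (\<lambda>c. real (Suc i - length c)) c
      = (1 - remainder w (length c)) * real (Suc i - length c) + remainder w (length c) * real (i - length c)"
    unfolding step_stick_prob_remainder by (simp add: sum_stick_breaking flip: sum_distrib_right)
  also have "\<dots> = real (Suc i - length c) - remainder w (length c) * unopened i c"
    by (simp add: unopened_def Suc_diff_le algebra_simps)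
  also have "\<dots> \<le> real (Suc i - length c) - remainder w i * unopened i c"
    using decseqD[OF decseq_remainder, of "length c" i] by (simp add: unopened_def)
  finally show ?thesis .
qed

text \<open>The number of tables missing until table \<open>i\<close> is open is non-negative, starts at \<open>i\<close> and drops on
  average by at least \<open>remainder w i\<close> per step while table \<open>i\<close> is unopened. This bounds the mean time
  until table \<open>i\<close> opens.\<close>

lemma sum_unopened_le:
  "(\<Sum>m<n. (step (stick_prob w) ^^ m) (unopened i) [1]) \<le> real i / remainder w i"
proof -
  let ?A = "\<lambda>n. (step (stick_prob w) ^^ n)" and ?G = "\<lambda>c :: nat list. real (Suc i - length c)"
  have "?A n ?G [1] + remainder w i * (\<Sum>m<n. ?A m (unopened i) [1]) \<le> real i"
  proof (induction n)
    case (Suc n)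
    have "?A (Suc n) ?G [1] = ?A n (step (stick_prob w) ?G) [1]"
      by (simp only: funpow_Suc_right comp_apply)
    also have "\<dots> \<le> ?A n (\<lambda>c. ?G c - remainder w i * unopened i c) [1]"
      by (intro step_pow_stick_mono step_missing_tables)
    also have "\<dots> = ?A n ?G [1] - remainder w i * ?A n (unopened i) [1]"
      by (simp add: step_pow_diff step_pow_cmult)
    finally show ?case using Suc by (simp add: distrib_left)
  qed simp
  moreover have "0 \<le> ?A n ?G [1]"
    using step_pow_stick_mono[of n "\<lambda>_. 0" ?G] by (simp add: step_pow_stick_const)
  ultimately have "remainder w i * (\<Sum>m<n. ?A m (unopened i) [1]) \<le> real i" by linarith
  then show ?thesis using remainder_pos[of i] by (simp add: pos_le_divide_eq mult.commute)
qed

definition deviation :: "nat \<Rightarrow> nat list \<Rightarrow> real" where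
  "deviation i c = table_size c i - stick_breaking w i * real (sum_list c)"

text \<open>While table \<open>i\<close> is open, its mean growth is exactly \<open>stick_breaking w i\<close>, so the deviation has no drift
  and its square grows by at most \<open>1\<close> per step. Before that, the deviation is at most the number of
  customers, which bounds the drift term.\<close>

lemma step_deviation_square:
  "step (stick_prob w) (\<lambda>c. (deviation i c)\<^sup>2) c
    \<le> (deviation i c)\<^sup>2 + 2 * real (sum_list c) * unopened i c + 1"
proof -
  define k where "k = length c"
  define v where "v = stick_breaking w i"
  define D where "D = deviation i c"
  \<comment> \<open>index \<open>k\<close> stands for the choice of a new table, which becomes table \<open>k\<close>\<close>
  define u where "u j = (if j < k then stick_breaking w j else remainder w k)" for j
  define \<delta> where "\<delta> j = (if j = i then 1 else 0) - v" for j
  have v: "0 \<le> v" "v \<le> 1"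
    unfolding v_def using stick_breaking_pos[of i] stick_breaking_le_1 by auto
  have u: "0 \<le> u j" "u j \<le> 1" for j
    unfolding u_def using stick_breaking_pos[of j] stick_breaking_le_1[of j] remainder_pos[of k] remainder_le_1[of k]
    by auto
  have sum_u: "(\<Sum>j\<le>k. u j * a j) = (\<Sum>j<k. stick_breaking w j * a j) + remainder w k * a k" for a
    by (simp add: lessThan_Suc_atMost[symmetric] u_def)
  have join: "deviation i (c[j := Suc (c ! j)]) = D + \<delta> j" if "j < k" for j
    using that unfolding deviation_def D_def \<delta>_def table_size_def k_def v_def
    by (simp add: sum_list_Suc_update nth_list_update algebra_simps)
  have new: "deviation i (c @ [1]) = D + \<delta> k"
    unfolding deviation_def D_def \<delta>_def table_size_def k_def v_def
    by (auto simp: nth_append algebra_simps)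
  have u1: "(\<Sum>j\<le>k. u j) = 1" using sum_u[of "\<lambda>_. 1"] sum_stick_breaking by simp
  have "(\<Sum>j\<le>k. u j * (if j = i then 1 else 0)) = (if i \<le> k then u i else 0)"
    by (simp add: if_distrib cong: if_cong)
  then have mean: "(\<Sum>j\<le>k. u j * \<delta> j) = (if i \<le> k then u i else 0) - v"
    unfolding \<delta>_def by (simp add: right_diff_distrib sum_subtractf u1 flip: sum_distrib_right)
  have drift: "2 * D * (\<Sum>j\<le>k. u j * \<delta> j) \<le> 2 * real (sum_list c) * unopened i c"
  proof (cases "i < k")
    case True
    then have "(\<Sum>j\<le>k. u j * \<delta> j) = 0" unfolding mean by (simp add: u_def v_def)
    then show ?thesis by (simp add: unopened_def)
  next
    case False
    then have D: "D = - v * real (sum_list c)"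
      unfolding D_def deviation_def table_size_def k_def v_def by simp
    define q where "q = (if i \<le> k then u i else 0)"
    have "v * (v - q) \<le> v * 1"
      using v u[of i] by (intro mult_left_mono) (auto simp: q_def)
    then have "v * (v - q) \<le> 1" using v by simp
    then have "real (sum_list c) * (v * (v - q)) \<le> real (sum_list c) * 1"
      by (intro mult_left_mono) auto
    then show ?thesis using False unfolding mean q_def[symmetric] D by (simp add: unopened_def k_def algebra_simps)
  qed
  have "step (stick_prob w) (\<lambda>c. (deviation i c)\<^sup>2) c = (\<Sum>j\<le>k. u j * (D + \<delta> j)\<^sup>2)"
    unfolding step_stick_prob_remainder sum_u k_def[symmetric] new by (simp add: join)
  also have "\<dots> \<le> (\<Sum>j\<le>k. u j * D\<^sup>2 + 2 * D * (u j * \<delta> j) + u j)"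
  proof (rule sum_mono)
    fix j
    have "\<bar>\<delta> j\<bar> \<le> 1" using v unfolding \<delta>_def by auto
    then have "u j * (\<delta> j)\<^sup>2 \<le> u j * 1" using u by (intro mult_left_mono) (auto simp: abs_square_le_1)
    then show "u j * (D + \<delta> j)\<^sup>2 \<le> u j * D\<^sup>2 + 2 * D * (u j * \<delta> j) + u j"
      by (simp add: power2_sum algebra_simps)
  qed
  also have "\<dots> = D\<^sup>2 + 2 * D * (\<Sum>j\<le>k. u j * \<delta> j) + 1"
    by (simp add: sum.distrib u1 flip: sum_distrib_left sum_distrib_right)
  finally show ?thesis using drift unfolding D_def by simp
qed

text \<open>The drift is only paid before table \<open>i\<close> opens, which takes bounded mean time; so the mean square
  deviation after \<open>n\<close> customers is of order \<open>n\<close>.\<close>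

lemma step_pow_deviation_square:
  "(step (stick_prob w) ^^ n) (\<lambda>c. (deviation i c)\<^sup>2) [1] \<le> real (Suc n) * (1 + 2 * real i / remainder w i)"
proof -
  let ?A = "\<lambda>n. (step (stick_prob w) ^^ n)" and ?D = "\<lambda>c. (deviation i c)\<^sup>2"
  have p: "0 \<le> ?A m (unopened i) [1]" for m
    using step_pow_stick_mono[of m "\<lambda>_. 0" "unopened i"] by (simp add: step_pow_stick_const unopened_def)
  have "?A n ?D [1] \<le> real (Suc n) + 2 * real n * (\<Sum>m<n. ?A m (unopened i) [1])"
  proof (induction n)
    case 0
    have "\<bar>deviation i [1]\<bar> \<le> 1"
      using stick_breaking_pos[of i] stick_breaking_le_1[of i]
      unfolding deviation_def table_size_def by (cases i) auto
    then show ?case by (simp add: abs_square_le_1)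
  next
    case (Suc n)
    let ?S = "\<Sum>m<n. ?A m (unopened i) [1]"
    have "?A (Suc n) ?D [1] = ?A n (step (stick_prob w) ?D) [1]"
      by (simp only: funpow_Suc_right comp_apply)
    also have "\<dots> \<le> ?A n (\<lambda>c. (?D c + (2 * real (Suc n)) * unopened i c) + 1) [1]"
    proof (rule step_pow_stick_mono)
      fix c assume "c \<in> compositions (Suc n)"
      then have "sum_list c = Suc n" by (simp add: compositions_def)
      then show "step (stick_prob w) ?D c \<le> (?D c + 2 * real (Suc n) * unopened i c) + 1"
        using step_deviation_square[of i c] by simp
    qed
    also have "\<dots> = ?A n ?D [1] + 2 * real (Suc n) * ?A n (unopened i) [1] + 1"
      by (simp only: step_pow_add step_pow_cmult step_pow_stick_const)
    also have "\<dots> \<le> real (Suc n) + 2 * real n * ?S + 2 * real (Suc n) * ?A n (unopened i) [1] + 1"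
      using Suc by simp
    also have "\<dots> \<le> real (Suc n) + 2 * real (Suc n) * ?S + 2 * real (Suc n) * ?A n (unopened i) [1] + 1"
      using sum_nonneg[of "{..<n}" "\<lambda>m. ?A m (unopened i) [1]"] p by (simp add: mult_right_mono)
    finally show ?case by (simp add: distrib_left)
  qed
  also have "\<dots> \<le> real (Suc n) + 2 * real (Suc n) * (real i / remainder w i)"
    using sum_unopened_le[of i n] sum_nonneg[of "{..<n}" "\<lambda>m. ?A m (unopened i) [1]"] p
    by (intro add_left_mono mult_mono) auto
  finally show ?thesis by (simp add: algebra_simps add_divide_distrib)
qed

text \<open>The mean square of the deviation divided by \<open>n\<close> is of order \<open>1 / n\<close>, so its mean absolute value is of
  order \<open>1 / sqrt n\<close>.\<close>

lemma table_fraction_LLN: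
  "(\<lambda>n. (step (stick_prob w) ^^ n) (\<lambda>c. \<bar>table_fraction c i - stick_breaking w i\<bar>) [1]) \<longlonglongrightarrow> 0"
proof -
  let ?A = "\<lambda>n. (step (stick_prob w) ^^ n)"
  define K where "K = 1 + 2 * real i / remainder w i"
  have upper: "?A n (\<lambda>c. \<bar>table_fraction c i - stick_breaking w i\<bar>) [1] \<le> (1 + K) / 2 * (1 / sqrt (real (Suc n)))" for n
  proof -
    define N where "N = real (Suc n)"
    have N: "0 < N" "sqrt N * sqrt N = N" unfolding N_def by auto
    have sq: "0 < sqrt N" using N by simp
    have "?A n (\<lambda>c. \<bar>table_fraction c i - stick_breaking w i\<bar>) [1]
        \<le> ?A n (\<lambda>c. 1 / (2 * sqrt N) + 1 / (2 * N * sqrt N) * (deviation i c)\<^sup>2) [1]"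
    proof (rule step_pow_stick_mono)
      fix c assume c: "c \<in> compositions (Suc n)"
      then have cN: "real (sum_list c) = N" by (simp add: compositions_def N_def)
      then have D: "deviation i c = N * (table_fraction c i - stick_breaking w i)"
        using N(1) unfolding table_fraction_eq deviation_def cN by (simp add: right_diff_distrib)
      define x where "x = \<bar>table_fraction c i - stick_breaking w i\<bar>"
      \<comment> \<open>arithmetic--geometric mean, balanced at the typical size \<open>1 / sqrt N\<close> of \<open>x\<close>\<close>
      have "0 \<le> (1 - x * sqrt N)\<^sup>2" by simp
      then have "2 * (x * sqrt N) \<le> 1 + x\<^sup>2 * N"
        using N by (simp add: power2_eq_square algebra_simps)
      then have "x \<le> (1 + x\<^sup>2 * N) / (2 * sqrt N)"
        using sq by (simp add: pos_le_divide_eq algebra_simps)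
      also have "\<dots> = 1 / (2 * sqrt N) + 1 / (2 * N * sqrt N) * (deviation i c)\<^sup>2"
        using N(1) sq unfolding D x_def by (simp add: power_mult_distrib field_simps power2_eq_square)
      finally show "\<bar>table_fraction c i - stick_breaking w i\<bar>
          \<le> 1 / (2 * sqrt N) + 1 / (2 * N * sqrt N) * (deviation i c)\<^sup>2" unfolding x_def .
    qed
    also have "\<dots> = 1 / (2 * sqrt N) + 1 / (2 * N * sqrt N) * ?A n (\<lambda>c. (deviation i c)\<^sup>2) [1]"
      by (simp only: step_pow_add step_pow_cmult step_pow_stick_const)
    also have "\<dots> \<le> 1 / (2 * sqrt N) + 1 / (2 * N * sqrt N) * (N * K)"
      using step_pow_deviation_square[of n i] N(1) sq unfolding N_def[symmetric] K_def
      by (intro add_left_mono mult_left_mono) auto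
    also have "\<dots> = (1 + K) / 2 * (1 / sqrt N)" using N(1) sq by (simp add: field_simps)
    finally show ?thesis unfolding N_def .
  qed
  have lower: "0 \<le> ?A n (\<lambda>c. \<bar>table_fraction c i - stick_breaking w i\<bar>) [1]" for n
    using step_pow_stick_mono[of n "\<lambda>_. 0" "\<lambda>c. \<bar>table_fraction c i - stick_breaking w i\<bar>"]
    by (simp add: step_pow_stick_const)
  have "(\<lambda>n. (1 + K) / 2 * (1 / sqrt (real (Suc n)))) \<longlonglongrightarrow> 0"
  proof -
    have "filterlim (\<lambda>n. sqrt (real (Suc n))) at_top sequentially"
      by (intro filterlim_compose[OF sqrt_at_top] filterlim_compose[OF filterlim_real_sequentially] filterlim_Suc)
    then have "(\<lambda>n. 1 / sqrt (real (Suc n))) \<longlonglongrightarrow> 0"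
      by (intro tendsto_divide_0[OF tendsto_const] filterlim_at_top_imp_at_infinity)
    from tendsto_mult_left[OF this, of "(1 + K) / 2"] show ?thesis by simp
  qed
  then show ?thesis
    by (rule tendsto_sandwich[OF always_eventually[OF allI] always_eventually[OF allI] tendsto_const, rotated 2])
      (rule lower, rule upper)
qed

text \<open>The fractions of the tables from \<open>K\<close> on add up to one minus those of the first \<open>K\<close>. Hence controlling
  the first \<open>K\<close> tables controls all of them, up to the remainder of the sticks.\<close>

lemma abs_table_fraction_diff_le:
  "\<bar>table_fraction c i - stick_breaking w i\<bar>
    \<le> remainder w K + (\<Sum>j<K. \<bar>table_fraction c j - stick_breaking w j\<bar>)"
proof (cases "i < K")
  case True
  then have "\<bar>table_fraction c i - stick_breaking w i\<bar> \<le> (\<Sum>j<K. \<bar>table_fraction c j - stick_breaking w j\<bar>)"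
    by (intro member_le_sum[of i "{..<K}" "\<lambda>j. \<bar>table_fraction c j - stick_breaking w j\<bar>"]) auto
  then show ?thesis using remainder_pos[of K] by simp
next
  case False
  have nonneg: "0 \<le> table_fraction c i" by (simp add: table_fraction_def)
  have "sum (table_fraction c) (insert i {..<K}) \<le> 1" by (rule sum_table_fraction_le_1) simp
  then have "table_fraction c i \<le> 1 - (\<Sum>j<K. table_fraction c j)" using False by simp
  also have "\<dots> = remainder w K + (\<Sum>j<K. stick_breaking w j - table_fraction c j)"
    by (simp add: sum_subtractf sum_stick_breaking)
  also have "\<dots> \<le> remainder w K + (\<Sum>j<K. \<bar>table_fraction c j - stick_breaking w j\<bar>)"
    by (intro add_left_mono sum_mono) simp
  finally have "table_fraction c i \<le> remainder w K + (\<Sum>j<K. \<bar>table_fraction c j - stick_breaking w j\<bar>)" .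
  moreover have "stick_breaking w i \<le> remainder w K + (\<Sum>j<K. \<bar>table_fraction c j - stick_breaking w j\<bar>)"
    using stick_breaking_le_remainder[of K i] False
    by (simp add: add_increasing2 sum_nonneg)
  ultimately show ?thesis using nonneg stick_breaking_pos[of i] by simp
qed

lemma nn_integral_stick_breaking:
  assumes "remainder w \<longlonglongrightarrow> 0"
  shows "(\<integral>\<^sup>+i. ennreal (stick_breaking w i) \<partial>count_space UNIV) = 1"
proof -
  have "stick_breaking w sums 1"
    unfolding sums_def sum_stick_breaking using tendsto_diff[OF tendsto_const assms, of 1] by simp
  then have "(\<lambda>i. ennreal (stick_breaking w i)) sums ennreal 1"
    by (rule sums_ennreal[THEN iffD2, rotated 2]) (simp_all add: less_imp_le[OF stick_breaking_pos])
  then show ?thesis by (simp add: nn_integral_count_space_nat sums_iff)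
qed

text \<open>No mass is lost in the limit because the sticks exhaust the unit interval; so the table fractions
  converge uniformly in the index, and ranking is continuous for uniform convergence.\<close>

lemma step_pow_ranked_tendsto:
  assumes rem: "remainder w \<longlonglongrightarrow> 0" and L: "0 \<le> L"
    and Lip: "\<And>x y e. (\<And>k. \<bar>x k - y k\<bar> \<le> e) \<Longrightarrow> \<bar>f x - f y\<bar> \<le> L * e"
  shows "(\<lambda>n. (step (stick_prob w) ^^ n) (\<lambda>c. f (decreasing_rearrangement (table_fraction c) UNIV)) [1])
    \<longlonglongrightarrow> f (decreasing_rearrangement (stick_breaking w) UNIV)"
proof -
  let ?A = "\<lambda>n. (step (stick_prob w) ^^ n)"
  let ?F = "\<lambda>c. f (decreasing_rearrangement (table_fraction c) UNIV)"
  let ?a = "f (decreasing_rearrangement (stick_breaking w) UNIV)"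
  let ?d = "\<lambda>j c. \<bar>table_fraction c j - stick_breaking w j\<bar>"
  have van: "vanishing (stick_breaking w) UNIV"
    by (rule vanishing_if_integrable) (simp add: nn_integral_stick_breaking[OF rem])
  have bound: "\<bar>?A n ?F [1] - ?a\<bar> \<le> L * (remainder w K + (\<Sum>j<K. ?A n (?d j) [1]))" for n K
  proof -
    have pt: "\<bar>?F c - ?a\<bar> \<le> L * (remainder w K + (\<Sum>j<K. ?d j c))" for c
    proof (rule Lip)
      fix k
      show "\<bar>decreasing_rearrangement (table_fraction c) UNIV k - decreasing_rearrangement (stick_breaking w) UNIV k\<bar>
          \<le> remainder w K + (\<Sum>j<K. ?d j c)"
        using remainder_pos[of K]
        by (intro abs_decreasing_rearrangement_diff_le vanishing_table_fraction van abs_table_fraction_diff_le)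
          (auto intro!: add_nonneg_nonneg sum_nonneg)
    qed
    have val: "?A n (\<lambda>c. L * (remainder w K + (\<Sum>j<K. ?d j c))) [1] = L * (remainder w K + (\<Sum>j<K. ?A n (?d j) [1]))"
      by (simp only: step_pow_cmult step_pow_add step_pow_sum[OF finite_lessThan] step_pow_stick_const)
    have "?A n (\<lambda>c. ?F c - ?a) [1] \<le> ?A n (\<lambda>c. L * (remainder w K + (\<Sum>j<K. ?d j c))) [1]"
      "?A n (\<lambda>c. ?a - ?F c) [1] \<le> ?A n (\<lambda>c. L * (remainder w K + (\<Sum>j<K. ?d j c))) [1]"
      using pt by (intro step_pow_stick_mono; simp add: abs_le_iff)+
    then show ?thesis unfolding val by (simp add: step_pow_diff step_pow_stick_const abs_le_iff)
  qed
  show ?thesis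
  proof (rule LIMSEQ_I)
    fix r :: real assume r: "0 < r"
    have "(\<lambda>K. L * remainder w K) \<longlonglongrightarrow> 0" using tendsto_mult_left[OF rem, of L] by simp
    then obtain K where K: "L * remainder w K < r"
      using order_tendstoD(2)[OF _ r] eventually_sequentially by (metis (no_types, lifting) order_refl)
    have "(\<lambda>n. L * (remainder w K + (\<Sum>j<K. ?A n (?d j) [1]))) \<longlonglongrightarrow> L * (remainder w K + (\<Sum>j<K. 0))"
      by (intro tendsto_mult_left tendsto_add tendsto_const tendsto_sum table_fraction_LLN)
    then have "\<forall>\<^sub>F n in sequentially. L * (remainder w K + (\<Sum>j<K. ?A n (?d j) [1])) < r"
      using K by (intro order_tendstoD(2)) auto
    then have "\<forall>\<^sub>F n in sequentially. \<bar>?A n ?F [1] - ?a\<bar> < r"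
      by eventually_elim (rule le_less_trans[OF bound])
    then show "\<exists>no. \<forall>n\<ge>no. norm (?A n ?F [1] - ?a) < r"
      by (simp add: eventually_sequentially)
  qed
qed

end

section \<open>Test functions that determine a law of sequences\<close>

text \<open>A continuous function that decreases from \<open>1\<close> to \<open>0\<close> on \<open>[t, t + 1 / m]\<close>, so that products of
  such functions approximate indicators of boxes by Lipschitz functions.\<close>

definition ramp :: "nat \<Rightarrow> real \<Rightarrow> real \<Rightarrow> real" where
  "ramp m t x = max 0 (min 1 (1 + real m * (t - x)))"

definition box_test :: "nat \<Rightarrow> nat \<Rightarrow> (nat \<Rightarrow> real) \<Rightarrow> (nat \<Rightarrow> real) \<Rightarrow> real" where
  "box_test m k t x = (\<Prod>i<k. ramp m (t i) (x i))"

lemma ramp_bounds: "0 \<le> ramp m t x" "ramp m t x \<le> 1"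
  unfolding ramp_def by auto

lemma ramp_Lipschitz: "\<bar>ramp m t x - ramp m t y\<bar> \<le> real m * \<bar>x - y\<bar>"
proof -
  have "\<bar>ramp m t x - ramp m t y\<bar> \<le> \<bar>real m * (t - x) - real m * (t - y)\<bar>"
    unfolding ramp_def by (auto simp: max_def min_def abs_if)
  also have "real m * (t - x) - real m * (t - y) = real m * (y - x)" by (simp add: algebra_simps)
  finally show ?thesis by (simp add: abs_mult abs_minus_commute)
qed

lemma box_test_bounds: "0 \<le> box_test m k t x" "box_test m k t x \<le> 1"
  unfolding box_test_def by (auto intro!: prod_nonneg prod_le_1 ramp_bounds)

lemma box_test_Lipschitz:
  assumes "\<And>i. \<bar>x i - y i\<bar> \<le> e"
  shows "\<bar>box_test m k t x - box_test m k t y\<bar> \<le> real k * real m * e"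
proof -
  have "\<bar>box_test m k t x - box_test m k t y\<bar> \<le> (\<Sum>i<k. \<bar>ramp m (t i) (x i) - ramp m (t i) (y i)\<bar>)"
    unfolding box_test_def real_norm_def[symmetric] by (rule norm_prod_diff) (auto simp: ramp_bounds)
  also have "\<dots> \<le> (\<Sum>i<k. real m * e)"
    using assms by (intro sum_mono order_trans[OF ramp_Lipschitz] mult_left_mono) auto
  finally show ?thesis by simp
qed

lemma ramp_tendsto: "(\<lambda>m. ramp m t x) \<longlonglongrightarrow> (if x \<le> t then 1 else 0)"
proof (cases "x \<le> t")
  case True
  then show ?thesis unfolding ramp_def by simp
next
  case False
  then have "filterlim (\<lambda>m. real m * (x - t)) at_top sequentially"
    by (intro filterlim_at_top_mult_tendsto_pos[OF tendsto_const _ filterlim_real_sequentially]) simp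
  then have "\<forall>\<^sub>F m in sequentially. 1 \<le> real m * (x - t)" by (simp add: filterlim_at_top)
  then have "\<forall>\<^sub>F m in sequentially. ramp m t x = 0"
    by eventually_elim (simp add: ramp_def algebra_simps)
  then show ?thesis using False by (simp add: tendsto_eventually)
qed

lemma box_test_tendsto:
  "(\<lambda>m. box_test m k t x) \<longlonglongrightarrow> indicator {x. \<forall>i<k. x i \<le> t i} x"
proof -
  have "(\<lambda>m. box_test m k t x) \<longlonglongrightarrow> (\<Prod>i<k. if x i \<le> t i then 1 else 0)"
    unfolding box_test_def by (intro tendsto_prod ramp_tendsto)
  also have "(\<Prod>i<k. if x i \<le> t i then 1 else 0 :: real) = indicator {x. \<forall>i<k. x i \<le> t i} x"
    by (auto split: split_indicator)
  finally show ?thesis .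
qed

lemma borel_measurable_box_test: "box_test m k t \<in> borel_measurable borel"
  unfolding box_test_def ramp_def
  by (intro borel_measurable_prod borel_measurable_max borel_measurable_min borel_measurable_add
      borel_measurable_times borel_measurable_diff borel_measurable_const measurable_product_coordinates)

definition boxes :: "(nat \<Rightarrow> real) set set" where
  "boxes = {{x. \<forall>i<k. x i \<le> t i} | k t. True}"

lemma box_borel: "{x :: nat \<Rightarrow> real. \<forall>i<k. x i \<le> t i} \<in> sets borel"
proof -
  have "{x \<in> space borel. \<forall>i\<in>{..<k}. x i \<le> t i} \<in> sets (borel :: (nat \<Rightarrow> real) measure)"
    by (intro sets.sets_Collect_finite_All borel_measurable_le measurable_product_coordinates
        borel_measurable_const) simp
  then show ?thesis by (simp add: lessThan_def)
qed

lemma Int_stable_boxes: "Int_stable boxes"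
proof (rule Int_stableI)
  fix a b assume "a \<in> boxes" "b \<in> boxes"
  then obtain k t k' t' where ab: "a = {x. \<forall>i<k. x i \<le> t i}" "b = {x. \<forall>i<k'. x i \<le> t' i}"
    unfolding boxes_def by auto
  define s where "s i = (if i < k \<and> i < k' then min (t i) (t' i) else if i < k then t i else t' i)" for i
  have "a \<inter> b = {x. \<forall>i<max k k'. x i \<le> s i}"
    unfolding ab s_def by (auto simp: less_max_iff_disj)
  then show "a \<inter> b \<in> boxes" unfolding boxes_def by blast
qed

lemma sets_borel_boxes: "sets (borel :: (nat \<Rightarrow> real) measure) = sigma_sets UNIV boxes"
proof (rule antisym)
  have sp: "space (sigma UNIV boxes) = UNIV" by (rule space_measure_of_conv)
  have st: "sets (sigma UNIV boxes) = sigma_sets UNIV boxes" by (rule sets_measure_of) simp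
  have "(\<lambda>x. x i) \<in> borel_measurable (sigma UNIV boxes)" for i
    unfolding borel_measurable_iff_le
  proof
    fix a
    \<comment> \<open>a half-space is exhausted by boxes whose remaining sides grow\<close>
    have "{x :: nat \<Rightarrow> real. x i \<le> a} = (\<Union>n. {x. \<forall>j<Suc i. x j \<le> (if j = i then a else real n)})"
    proof (intro equalityI subsetI)
      fix x :: "nat \<Rightarrow> real" assume x: "x \<in> {x. x i \<le> a}"
      obtain n where n: "Max (x ` {..i}) \<le> real n" using real_arch_simple by blast
      have "x j \<le> real n" if "j < Suc i" for j
        using that n Max_ge[of "x ` {..i}" "x j"] by fastforce
      then show "x \<in> (\<Union>n. {x. \<forall>j<Suc i. x j \<le> (if j = i then a else real n)})" using x by auto
    qed auto
    also have "\<dots> \<in> sigma_sets UNIV boxes"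
    proof (intro sigma_sets.Union sigma_sets.Basic)
      fix n :: nat
      show "{x. \<forall>j<Suc i. x j \<le> (if j = i then a else real n)} \<in> boxes"
        unfolding boxes_def
        by (intro CollectI exI[of _ "Suc i"] exI[of _ "\<lambda>j. if j = i then a else real n"]) simp
    qed
    finally show "{w \<in> space (sigma UNIV boxes). w i \<le> a} \<in> sets (sigma UNIV boxes)"
      by (simp add: sp st)
  qed
  then have id: "(\<lambda>x. x) \<in> sigma UNIV boxes \<rightarrow>\<^sub>M (borel :: (nat \<Rightarrow> real) measure)"
    by (rule measurable_coordinatewise_then_product)
  show "sets (borel :: (nat \<Rightarrow> real) measure) \<subseteq> sigma_sets UNIV boxes"
  proof
    fix A :: "(nat \<Rightarrow> real) set" assume "A \<in> sets borel"
    then show "A \<in> sigma_sets UNIV boxes" using measurable_sets[OF id] by (simp add: sp st)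
  qed
  have "boxes \<subseteq> sets (borel :: (nat \<Rightarrow> real) measure)"
  proof
    fix A assume "A \<in> boxes"
    then obtain k t where "A = {x. \<forall>i<k. x i \<le> t i}" unfolding boxes_def mem_Collect_eq by (elim exE conjE)
    then show "A \<in> sets borel" using box_borel by simp
  qed
  from sets.sigma_sets_subset[OF this]
  show "sigma_sets UNIV boxes \<subseteq> sets (borel :: (nat \<Rightarrow> real) measure)" by simp
qed

text \<open>Letting the ramps become steep, the test functions recover the measures of boxes, which form a
  generator closed under intersection.\<close>

lemma measure_eqI_box_test:
  fixes \<mu> \<nu> :: "(nat \<Rightarrow> real) measure"
  assumes "prob_space \<mu>" "prob_space \<nu>" and sets: "sets \<mu> = sets borel" "sets \<nu> = sets borel"
    and eq: "\<And>m k t. integral\<^sup>L \<mu> (box_test m k t) = integral\<^sup>L \<nu> (box_test m k t)"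
  shows "\<mu> = \<nu>"
proof -
  have box: "(\<lambda>m. integral\<^sup>L \<rho> (box_test m k t)) \<longlonglongrightarrow> measure \<rho> {x. \<forall>i<k. x i \<le> t i}"
    if "prob_space \<rho>" "sets \<rho> = sets borel" for \<rho> :: "(nat \<Rightarrow> real) measure" and k t
  proof -
    interpret prob_space \<rho> by fact
    have sp: "space \<rho> = UNIV" using sets_eq_imp_space_eq[OF that(2)] by simp
    have S: "{x. \<forall>i<k. x i \<le> t i} \<in> sets \<rho>" using box_borel that(2) by simp
    have m: "box_test m k t \<in> borel_measurable \<rho>" for m
      using borel_measurable_box_test by (simp add: measurable_cong_sets[OF that(2) refl])
    have "(\<lambda>m. integral\<^sup>L \<rho> (box_test m k t)) \<longlonglongrightarrow> integral\<^sup>L \<rho> (indicator {x. \<forall>i<k. x i \<le> t i})"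
    proof (rule integral_dominated_convergence[where w="\<lambda>_. 1"])
      show "indicator {x. \<forall>i<k. x i \<le> t i} \<in> borel_measurable \<rho>" using S by (rule borel_measurable_indicator)
      show "AE x in \<rho>. (\<lambda>m. box_test m k t x) \<longlonglongrightarrow> indicator {x. \<forall>i<k. x i \<le> t i} x"
        by (rule AE_I2) (rule box_test_tendsto)
      show "AE x in \<rho>. norm (box_test m k t x) \<le> 1" for m
        by (rule AE_I2) (simp add: box_test_bounds)
    qed (rule m, simp)
    then show ?thesis using S by (simp add: sp)
  qed
  have m: "measure \<mu> {x. \<forall>i<k. x i \<le> t i} = measure \<nu> {x. \<forall>i<k. x i \<le> t i}" for k t
    using box[OF assms(1) sets(1), of k t] box[OF assms(2) sets(2), of k t] unfolding eq
    by (rule LIMSEQ_unique)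
  interpret \<mu>: prob_space \<mu> by fact
  interpret \<nu>: prob_space \<nu> by fact
  show ?thesis
  proof (rule measure_eqI_generator_eq[OF Int_stable_boxes, where A="\<lambda>_. UNIV"])
    show "sets \<mu> = sigma_sets UNIV boxes" "sets \<nu> = sigma_sets UNIV boxes"
      using sets sets_borel_boxes by auto
    show "emeasure \<mu> X = emeasure \<nu> X" if X: "X \<in> boxes" for X
    proof -
      obtain k t where "X = {x. \<forall>i<k. x i \<le> t i}" using X unfolding boxes_def mem_Collect_eq by (elim exE conjE)
      then show ?thesis using m[of k t] by (simp add: \<mu>.emeasure_eq_measure \<nu>.emeasure_eq_measure)
    qed
    have "UNIV \<in> boxes"
      unfolding boxes_def by (intro CollectI exI[of _ 0] exI[of _ "\<lambda>_. 0"]) simp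
    then show "range (\<lambda>_ :: nat. UNIV) \<subseteq> boxes" by simp
  qed auto
qed

section \<open>The law of the ranked lengths\<close>

context
  fixes \<alpha> \<theta>\<^sub>1 \<theta>\<^sub>2 :: real
  assumes \<alpha>: "0 < \<alpha>" "\<alpha> < 1" and \<theta>: "- \<alpha> < \<theta>\<^sub>1 + \<theta>\<^sub>2 - \<alpha>"
begin

abbreviation "sticks \<equiv> stick_law \<alpha> (\<theta>\<^sub>1 + \<theta>\<^sub>2 - \<alpha>)"

lemma AE_sticks: "AE w in sticks. (\<forall>i. 0 < w i \<and> w i < 1) \<and> remainder w \<longlonglongrightarrow> 0"
  using AE_stick_law[OF \<alpha> \<theta>] AE_stick_remainder_tendsto_0[OF \<alpha> \<theta>]
  by eventually_elim (simp add: remainder_def[abs_def])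

lemma measurable_ranked_sticks: "(\<lambda>w. decreasing_rearrangement (stick_breaking w) UNIV) \<in> sticks \<rightarrow>\<^sub>M borel"
proof (rule borel_measurable_decreasing_rearrangement_seq)
  note measurable_stick[OF \<alpha> \<theta>, measurable]
  show "(\<lambda>w. stick_breaking w i) \<in> borel_measurable sticks" for i
    unfolding stick_breaking_def by measurable
qed

lemma expectation_crp_tendsto_sticks:
  "(\<lambda>n. (step (crp_prob \<alpha> (\<theta>\<^sub>1 + \<theta>\<^sub>2 - \<alpha>)) ^^ n) (\<lambda>c. box_test m k t (decreasing_rearrangement (table_fraction c) UNIV)) [1])
    \<longlonglongrightarrow> (\<integral>w. box_test m k t (decreasing_rearrangement (stick_breaking w) UNIV) \<partial>sticks)"
proof -
  let ?F = "\<lambda>c. box_test m k t (decreasing_rearrangement (table_fraction c) UNIV)"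
  interpret prob_space sticks by (rule prob_space_stick_law[OF \<alpha> \<theta>])
  have mix: "has_bochner_integral sticks (\<lambda>w. (step (stick_prob w) ^^ n) ?F [1]) ((step (crp_prob \<alpha> (\<theta>\<^sub>1 + \<theta>\<^sub>2 - \<alpha>)) ^^ n) ?F [1])" for n
    by (rule stick_mixture[OF \<alpha> \<theta>])
  have "(\<lambda>n. \<integral>w. (step (stick_prob w) ^^ n) ?F [1] \<partial>sticks)
    \<longlonglongrightarrow> (\<integral>w. box_test m k t (decreasing_rearrangement (stick_breaking w) UNIV) \<partial>sticks)"
  proof (rule integral_dominated_convergence[where w="\<lambda>_. 1"])
    show "(\<lambda>w. box_test m k t (decreasing_rearrangement (stick_breaking w) UNIV)) \<in> borel_measurable sticks"
      by (rule measurable_compose[OF measurable_ranked_sticks borel_measurable_box_test])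
    show "(\<lambda>w. (step (stick_prob w) ^^ n) ?F [1]) \<in> borel_measurable sticks" for n
      using mix by (auto simp: has_bochner_integral_iff)
    show "AE w in sticks. (\<lambda>n. (step (stick_prob w) ^^ n) ?F [1])
        \<longlonglongrightarrow> box_test m k t (decreasing_rearrangement (stick_breaking w) UNIV)"
      using AE_sticks
      by eventually_elim
        (rule step_pow_ranked_tendsto[where L="real k * real m"], auto intro: box_test_Lipschitz)
    show "AE w in sticks. norm ((step (stick_prob w) ^^ n) ?F [1]) \<le> 1" for n
      using AE_sticks
    proof eventually_elim
      case (elim w)
      then have w: "\<forall>i. 0 < w i \<and> w i < 1" by blast
      show ?case
        using step_pow_stick_mono[OF w, of n "\<lambda>_. 0" ?F] step_pow_stick_mono[OF w, of n ?F "\<lambda>_. 1"]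
        by (simp add: step_pow_stick_const[OF w] box_test_bounds)
    qed
  qed simp
  then show ?thesis using mix by (simp add: has_bochner_integral_iff)
qed

context
  fixes M :: "'a measure" and C and \<beta> :: "'a \<Rightarrow> real set set"
  assumes oCRP: "is_oCRP \<alpha> \<theta>\<^sub>1 \<theta>\<^sub>2 M C"
    and \<beta>: "\<beta> \<in> M \<rightarrow>\<^sub>M borel_IH1"
    and conv: "AE \<omega> in M. (\<lambda>n. d_H (scale (1 / real n) (composition_partition (C n \<omega>))) (\<beta> \<omega>)) \<longlonglongrightarrow> 0"
begin

interpretation prob_space M using oCRP unfolding is_oCRP_def by blast

lemma measurable_ranked_limit: "(\<lambda>\<omega>. ranked_lengths (\<beta> \<omega>)) \<in> M \<rightarrow>\<^sub>M borel"
  using measurable_compose[OF \<beta> measurable_ranked_lengths] unfolding borel_nabla_def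
  by (simp add: measurable_restrict_space2_iff)

text \<open>This is where convergence in \<open>d_H\<close> enters: ranked lengths are Lipschitz for \<open>d_H\<close>, and those of the
  rescaled composition are its ranked table fractions.\<close>

lemma ranked_composition_tendsto:
  "AE \<omega> in M. (\<lambda>n. box_test m k t (decreasing_rearrangement (table_fraction (C (Suc n) \<omega>)) UNIV))
      \<longlonglongrightarrow> box_test m k t (ranked_lengths (\<beta> \<omega>))"
  using conv AE_oCRP_compositions[OF oCRP] AE_space
proof eventually_elim
  case (elim \<omega>)
  let ?P = "\<lambda>n. scale (1 / real n) (composition_partition (C n \<omega>))"
  have \<beta>IH: "\<beta> \<omega> \<in> IH1" using measurable_space[OF \<beta> elim(3)] by (simp add: space_borel_IH1)
  have sub: "IH1 \<subseteq> IH" unfolding IH_def IH1_def by blast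
  have bound: "\<bar>box_test m k t (decreasing_rearrangement (table_fraction (C (Suc n) \<omega>)) UNIV)
      - box_test m k t (ranked_lengths (\<beta> \<omega>))\<bar> \<le> real k * real m * (2 * d_H (?P (Suc n)) (\<beta> \<omega>))" for n
  proof (rule box_test_Lipschitz)
    fix i
    have c: "C (Suc n) \<omega> \<in> compositions (Suc n)" using elim(2) by simp
    have "?P (Suc n) \<in> IH" using interval_partition_scaled_composition[OF c] sub by auto
    then show "\<bar>decreasing_rearrangement (table_fraction (C (Suc n) \<omega>)) UNIV i - ranked_lengths (\<beta> \<omega>) i\<bar>
        \<le> 2 * d_H (?P (Suc n)) (\<beta> \<omega>)"
      using ranked_lengths_Lipschitz[of "?P (Suc n)" "\<beta> \<omega>" i] ranked_lengths_scaled_composition[OF c] \<beta>IH sub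
      by auto
  qed
  have "(\<lambda>n. real k * real m * (2 * d_H (?P (Suc n)) (\<beta> \<omega>))) \<longlonglongrightarrow> real k * real m * (2 * 0)"
    by (intro tendsto_mult_left LIMSEQ_Suc elim(1))
  then have "(\<lambda>n. real k * real m * (2 * d_H (?P (Suc n)) (\<beta> \<omega>))) \<longlonglongrightarrow> 0" by simp
  then have "(\<lambda>n. box_test m k t (decreasing_rearrangement (table_fraction (C (Suc n) \<omega>)) UNIV)
      - box_test m k t (ranked_lengths (\<beta> \<omega>))) \<longlonglongrightarrow> 0"
    by (rule Lim_null_comparison[rotated]) (intro always_eventually allI, simp only: real_norm_def bound)
  then show ?case by (rule LIM_zero_cancel)
qed

text \<open>Both sides are limits of one sequence. For each number of customers, ranked table fractions have the
  same mean in the ordered process, in the process with new tables at the end, and in the mixture over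
  the sticks.\<close>

lemma expectation_ranked_limit:
  "expectation (\<lambda>\<omega>. box_test m k t (ranked_lengths (\<beta> \<omega>)))
    = (\<integral>w. box_test m k t (decreasing_rearrangement (stick_breaking w) UNIV) \<partial>sticks)"
proof -
  let ?F = "\<lambda>c. box_test m k t (decreasing_rearrangement (table_fraction c) UNIV)"
  have sym: "symmetric ?F"
    unfolding symmetric_def by (intro allI impI arg_cong[of _ _ "box_test m k t"])
      (rule decreasing_rearrangement_table_fraction_cong)
  have lim: "(\<lambda>n. expectation (\<lambda>\<omega>. ?F (C (Suc n) \<omega>))) \<longlonglongrightarrow> expectation (\<lambda>\<omega>. box_test m k t (ranked_lengths (\<beta> \<omega>)))"
  proof (rule integral_dominated_convergence[where w="\<lambda>_. 1"])
    show "(\<lambda>\<omega>. box_test m k t (ranked_lengths (\<beta> \<omega>))) \<in> borel_measurable M"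
      by (rule measurable_compose[OF measurable_ranked_limit borel_measurable_box_test])
    have C: "C (Suc n) \<in> M \<rightarrow>\<^sub>M count_space UNIV" for n using oCRP unfolding is_oCRP_def by simp
    show "(\<lambda>\<omega>. ?F (C (Suc n) \<omega>)) \<in> borel_measurable M" for n
      by (rule measurable_compose[OF C]) simp
  qed (simp_all add: ranked_composition_tendsto box_test_bounds)
  have E: "expectation (\<lambda>\<omega>. ?F (C (Suc n) \<omega>)) = (step (crp_prob \<alpha> (\<theta>\<^sub>1 + \<theta>\<^sub>2 - \<alpha>)) ^^ n) ?F [1]" for n
    using expectation_oCRP[OF oCRP, of ?F n] step_pow_seating_prob_symmetric[OF sym, of "[1]"] by simp
  show ?thesis
    using lim unfolding E by (rule LIMSEQ_unique[OF _ expectation_crp_tendsto_sticks])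
qed

lemma distr_ranked_limit:
  "distr M borel (\<lambda>\<omega>. ranked_lengths (\<beta> \<omega>))
    = distr sticks borel (\<lambda>w. decreasing_rearrangement (stick_breaking w) UNIV)"
proof (rule measure_eqI_box_test)
  show "prob_space (distr M borel (\<lambda>\<omega>. ranked_lengths (\<beta> \<omega>)))"
    by (rule prob_space_distr[OF measurable_ranked_limit])
  show "prob_space (distr sticks borel (\<lambda>w. decreasing_rearrangement (stick_breaking w) UNIV))"
    by (rule prob_space.prob_space_distr[OF prob_space_stick_law[OF \<alpha> \<theta>] measurable_ranked_sticks])
  show "integral\<^sup>L (distr M borel (\<lambda>\<omega>. ranked_lengths (\<beta> \<omega>))) (box_test m k t)
     = integral\<^sup>L (distr sticks borel (\<lambda>w. decreasing_rearrangement (stick_breaking w) UNIV)) (box_test m k t)" for m k t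
    by (simp add: integral_distr[OF measurable_ranked_limit borel_measurable_box_test]
        integral_distr[OF measurable_ranked_sticks borel_measurable_box_test] expectation_ranked_limit)
qed simp_all

end

end

theorem proposition2p7:
  fixes \<alpha> \<theta>\<^sub>1 \<theta>\<^sub>2 :: real
    and M :: "'a measure" and X :: "'a \<Rightarrow> real set set"
  assumes "0 < \<alpha>" "\<alpha> < 1" "0 \<le> \<theta>\<^sub>1" "0 \<le> \<theta>\<^sub>2" "0 < \<theta>\<^sub>1 + \<theta>\<^sub>2"
    and "prob_space M"
    and "X \<in> M \<rightarrow>\<^sub>M borel_IH1"
    and "is_PDIP \<alpha> \<theta>\<^sub>1 \<theta>\<^sub>2 (distr M borel_IH1 X)"
  shows "(\<lambda>\<omega>. ranked_lengths (X \<omega>)) \<in> M \<rightarrow>\<^sub>M borel_nabla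
     \<and> distr M borel_nabla (\<lambda>\<omega>. ranked_lengths (X \<omega>)) = PD \<alpha> (\<theta>\<^sub>1 + \<theta>\<^sub>2 - \<alpha>)"
proof
  show meas: "(\<lambda>\<omega>. ranked_lengths (X \<omega>)) \<in> M \<rightarrow>\<^sub>M borel_nabla"
    by (rule measurable_compose[OF assms(7) measurable_ranked_lengths])
  obtain M' :: "(nat \<Rightarrow> nat list) measure" and C \<beta> where P: "is_oCRP \<alpha> \<theta>\<^sub>1 \<theta>\<^sub>2 M' C"
    and \<beta>: "\<beta> \<in> M' \<rightarrow>\<^sub>M borel_IH1"
    and conv: "AE \<omega> in M'. (\<lambda>n. d_H (scale (1 / real n) (composition_partition (C n \<omega>))) (\<beta> \<omega>)) \<longlonglongrightarrow> 0"
    and law: "distr M borel_IH1 X = distr M' borel_IH1 \<beta>"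
    using assms(8) unfolding is_PDIP_def by blast
  have \<theta>: "- \<alpha> < \<theta>\<^sub>1 + \<theta>\<^sub>2 - \<alpha>" using assms(5) by simp
  have "distr M borel_nabla (\<lambda>\<omega>. ranked_lengths (X \<omega>)) = distr (distr M borel_IH1 X) borel_nabla ranked_lengths"
    by (simp add: distr_distr[OF measurable_ranked_lengths assms(7)] comp_def)
  also have "\<dots> = distr M' borel_nabla (\<lambda>\<omega>. ranked_lengths (\<beta> \<omega>))"
    unfolding law by (simp add: distr_distr[OF measurable_ranked_lengths \<beta>] comp_def)
  also have "\<dots> = restrict_space (distr M' borel (\<lambda>\<omega>. ranked_lengths (\<beta> \<omega>))) nabla"
    unfolding borel_nabla_def
  proof (rule restrict_distr[symmetric])
    show "(\<lambda>\<omega>. ranked_lengths (\<beta> \<omega>)) \<in> M' \<rightarrow>\<^sub>M borel"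
      by (rule measurable_ranked_limit[OF assms(1,2) \<theta> P \<beta> conv])
    show "(\<lambda>\<omega>. ranked_lengths (\<beta> \<omega>)) \<in> space M' \<rightarrow> nabla"
      using measurable_space[OF \<beta>] by (auto simp: space_borel_IH1 ranked_lengths_in_nabla)
  qed (simp add: nabla_borel)
  also have "\<dots> = PD \<alpha> (\<theta>\<^sub>1 + \<theta>\<^sub>2 - \<alpha>)"
    unfolding PD_def distr_ranked_limit[OF assms(1,2) \<theta> P \<beta> conv] stick_law_def ..
  finally show "distr M borel_nabla (\<lambda>\<omega>. ranked_lengths (X \<omega>)) = PD \<alpha> (\<theta>\<^sub>1 + \<theta>\<^sub>2 - \<alpha>)" .
qed

end
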